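(* Let $E\subset\mathbb{R}^n$ be a bounded domain (bounded non-empty open set). For a wavelet system $\{\phi_{0,k}\}\cup\{\psi_{i,j,k}\}$ and $j \in \mathbb{N}_0$ define $$\Omega_j:= \left\{r\in \mathbb{Z}^n:\ \exists\ i\in\{1,\ldots,2^n-1\}\ \text{such that}\ \mathrm{supp}\, \psi_{i,j,r} \cap \partial E \neq \emptyset\right\}.$$ Suppose that, for the underlying wavelet system (one admissible for the space $B^{s,\tau}_{p,q}(\mathbb{R}^n)$ under consideration, for each of the parameter tuples $(s,\tau,p,q)$ occurring in the definition of maximal regularity), there is a constant $C$ such that for every dyadic cube $P= Q_{\ell,m}$ with $\ell \in \mathbb{N}_0$ and $m \in\mathbb{Z}^n$, $$\left|\Omega_j \cap \{r \in \mathbb{Z}^n:\ Q_{j,r} \subset P\}\right|\le C\, 2^{(j-\ell)(n-1)}, \quad \forall\ j \in\{\ell,\ell+1,\ldots\},$$ with $C$ independent of $P$ and $j$. Then ${\bf 1}_E$ has the maximal regularity.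
   Context: ${\bf 1}_E$ is the characteristic function of $E$, $\partial E$ the boundary; $|\cdot|$ of a discrete set is its cardinality. Dyadic cubes: for $j\in\mathbb{Z}$, $k\in\mathbb{Z}^n$ let $Q_{j,k}:=2^{-j}([0,1)^n+k)$; $\mathcal{Q}$ is the set of all of them; $\ell(P)$ is the edge length of $P$ and $j_P:=-\log_2\ell(P)$. Function spaces: fix $\varphi_0,\varphi\in\mathcal{S}(\mathbb{R}^n)$ with real-valued nonnegative Fourier transforms such that $\mathrm{supp}\,\mathcal{F}\varphi_0\subset\{|\xi|\le 2\}$, $|\mathcal{F}\varphi_0(\xi)|\ge C>0$ for $|\xi|\le 5/3$, $\mathrm{supp}\,\mathcal{F}\varphi\subset\{1/2\le|\xi|\le 2\}$, $|\mathcal{F}\varphi(\xi)|\ge C>0$ for $3/5\le|\xi|\le 5/3$; put $\varphi_j:=2^{jn}\varphi(2^j\cdot)$ for $j\ge 1$. For $s\in\mathbb{R}$, $\tau\in[0,\infty)$, $p,q\in(0,\infty]$, the Besov-type space $B^{s,\tau}_{p,q}(\mathbb{R}^n)$ is the set of all $f\in\mathcal{S}'(\mathbb{R}^n)$ with $$\|f\|_{B^{s,\tau}_{p,q}(\mathbb{R}^n)}:=\sup_{P\in\mathcal{Q}}\frac1{|P|^{\tau}}\Big\{\sum_{j=\max\{j_P,0\}}^\infty 2^{js q}\Big[\int_P|\varphi_j\ast f(x)|^p\,dx\Big]^{q/p}\Big\}^{1/q}<\infty,$$ with the usual modifications if $p=\infty$ and/or $q=\infty$. Maximal regularity: for a bounded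 measurable set $E\subset\mathbb{R}^n$ of positive measure, ${\bf 1}_E$ (or $E$) has maximal regularity if for all $p\in[1,\infty]$: for every $\tau\in(0,\frac{n-1}{np}]$ one has ${\bf 1}_E\in B^{1/p,\tau}_{p,\infty}(\mathbb{R}^n)$; and for every $\tau\in(\frac{n-1}{np},\infty)$ one has ${\bf 1}_E\in B^{s,\tau}_{p,q}(\mathbb{R}^n)$ with $s=n(\frac1p-\tau)$ and all $q\in[1,\infty]$. The parameter tuples occurring in this definition are $(1/p,\tau,p,\infty)$ in the first case and $(n(\frac1p-\tau),\tau,p,q)$ in the second. Wavelet systems: starting from a compactly supported orthonormal scaling function and wavelet on $\mathbb{R}$, tensor products give $\phi,\psi_1,\dots,\psi_{2^n-1}\in C^{N_1}(\mathbb{R}^n)$ with compact supports such that, with $\phi_{j,k}:=2^{jn/2}\phi(2^j\cdot-k)$ and $\psi_{i,j,k}:=2^{jn/2}\psi_i(2^j\cdot-k)$, the system $\{\phi_{0,k}:k\in\mathbb{Z}^n\}\cup\{\psi_{i,j,k}:1\le i\le 2^n-1,\ j\in\mathbb{N}_0,\ k\in\mathbb{Z}^n\}$ is an orthonormal basis of $L^2(\mathbb{R}^n)$ and $\int\psi_{i,j,k}(x)x^\gamma\,dx=0$ for $|\gamma|\le N_1$. Such a system is called admissible for $B^{s,\tau}_{p,q}(\mathbb{R}^n)$ if $N_1=N_1(s,\tau,p,q)$ is large enough that the wavelet characterization holds: $\|f\|_{B^{s,\tau}_{p,q}(\mathbb{R}^n)}$ is equivalent to $\|\lambda(f)\|_{b^{s,\tau}_{p,q}(\mathbb{R}^n)}$,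 where $\lambda_k(f)=\langle f,\phi_{0,k}\rangle$, $\lambda_{i,j,k}(f)=\langle f,\psi_{i,j,k}\rangle$ and $$\|\lambda\|_{b^{s,\tau}_{p,q}}:=\sup_{P\in\mathcal{Q},|P|\ge1}\frac1{|P|^\tau}\Big\{\sum_{m:\,Q_{0,m}\subset P}|\lambda_m|^p\Big\}^{1/p}+\sup_{P\in\mathcal{Q}}\frac1{|P|^\tau}\Big\{\sum_{j=\max\{j_P,0\}}^\infty2^{j(s+\frac n2-\frac np)q}\sum_{i=1}^{2^n-1}\Big[\sum_{m:\,Q_{j,m}\subset P}|\lambda_{i,j,m}|^p\Big]^{q/p}\Big\}^{1/q}.$$ The hypothesis means: for each occurring tuple there is an admissible wavelet system (with its own $\Omega_j$ and constant $C$) for which the counting bound holds. *)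

theory Defs
  imports "HOL-Analysis.Analysis" "HOL-Probability.Essential_Supremum"
begin

section \<open>Test functions and tempered distributions\<close>

definition supp :: "('a::topological_space \<Rightarrow> 'b::zero) \<Rightarrow> 'a set" where
  "supp f = closure {x. f x \<noteq> 0}"

primrec Ck :: "nat \<Rightarrow> ('a::euclidean_space \<Rightarrow> 'b::real_normed_vector) \<Rightarrow> bool" where
  "Ck 0 f \<longleftrightarrow> continuous_on UNIV f"
| "Ck (Suc k) f \<longleftrightarrow> (\<forall>x. f differentiable (at x)) \<and>
     (\<forall>b\<in>Basis. Ck k (\<lambda>x. frechet_derivative f (at x) b))"

text \<open>Partial derivatives of higher order are indexed by lists of basis vectors instead of
  multi-indices; for smooth functions the order of the entries is irrelevant.\<close>

primrec iter_deriv :: "'a::euclidean_space list \<Rightarrow> ('a \<Rightarrow> 'b::real_normed_vector) \<Rightarrow> 'a \<Rightarrow> 'b" where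
  "iter_deriv [] f = f"
| "iter_deriv (v # vs) f = iter_deriv vs (\<lambda>x. frechet_derivative f (at x) v)"

definition diff_ops :: "nat \<Rightarrow> 'a::euclidean_space list set" where
  "diff_ops N = {vs. set vs \<subseteq> Basis \<and> length vs \<le> N}"

definition schwartz :: "('a::euclidean_space \<Rightarrow> complex) \<Rightarrow> bool" where
  "schwartz \<eta> \<longleftrightarrow> (\<forall>k. Ck k \<eta>) \<and>
     (\<forall>N. \<forall>vs\<in>diff_ops N. bounded (range (\<lambda>x. (1 + norm x) ^ N *\<^sub>R iter_deriv vs \<eta> x)))"

definition schwartz_norm :: "nat \<Rightarrow> ('a::euclidean_space \<Rightarrow> complex) \<Rightarrow> real" where
  "schwartz_norm N \<eta> =
     (SUP (vs, x) \<in> diff_ops N \<times> UNIV. (1 + norm x) ^ N * norm (iter_deriv vs \<eta> x))"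

text \<open>A distribution is a functional on all complex-valued functions, of which only the values
  on Schwartz functions matter. Continuity is expressed by the increasing seminorms above.\<close>

definition tempered_distribution :: "(('a::euclidean_space \<Rightarrow> complex) \<Rightarrow> complex) \<Rightarrow> bool" where
  "tempered_distribution f \<longleftrightarrow>
     (\<forall>a \<eta> \<theta>. schwartz \<eta> \<and> schwartz \<theta> \<longrightarrow> f (\<lambda>x. a * \<eta> x + \<theta> x) = a * f \<eta> + f \<theta>) \<and>
     (\<exists>N C. \<forall>\<eta>. schwartz \<eta> \<longrightarrow> norm (f \<eta>) \<le> C * schwartz_norm N \<eta>)"

definition indicator_distribution :: "'a::euclidean_space set \<Rightarrow> ('a \<Rightarrow> complex) \<Rightarrow> complex" where
  "indicator_distribution E \<eta> = (LINT x:E|lebesgue. \<eta> x)"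

text \<open>The bracket is bilinear, so \<open>\<eta> * f\<close> at \<open>x\<close> is \<open>f\<close> applied to \<open>\<eta> (x - \<cdot>)\<close>.\<close>

definition convolution ::
  "('a::euclidean_space \<Rightarrow> complex) \<Rightarrow> (('a \<Rightarrow> complex) \<Rightarrow> complex) \<Rightarrow> 'a \<Rightarrow> complex" where
  "convolution \<eta> f x = f (\<lambda>y. \<eta> (x - y))"

definition fourier :: "('a::euclidean_space \<Rightarrow> complex) \<Rightarrow> 'a \<Rightarrow> complex" where
  "fourier \<eta> \<xi> =
     of_real ((2 * pi) powr (- real DIM('a) / 2)) * (LINT x|lborel. cis (- (x \<bullet> \<xi>)) * \<eta> x)"


section \<open>Dyadic cubes\<close>

definition dyadic_cube :: "int \<Rightarrow> int ^ 'n \<Rightarrow> (real ^ 'n) set" where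
  "dyadic_cube j k =
     {x. \<forall>i. 2 powi (- j) * of_int (k $ i) \<le> x $ i \<and> x $ i < 2 powi (- j) * (of_int (k $ i) + 1)}"


section \<open>Besov-type spaces\<close>

definition ennreal_powr :: "ennreal \<Rightarrow> real \<Rightarrow> ennreal" where
  "ennreal_powr x a = (if x = \<infinity> then \<infinity> else ennreal (enn2real x powr a))"

text \<open>\<open>exponent_inverse p\<close> is \<open>1/p\<close>, with \<open>1/\<infinity> = 0\<close>.\<close>

definition exponent_inverse :: "ennreal \<Rightarrow> real" where
  "exponent_inverse p = enn2real (inverse p)"

text \<open>Used both for Lebesgue measure and, in the form of sequence (quasi-)norms, for counting
  measure; on the latter the essential supremum is the supremum.\<close>

definition lp_norm :: "ennreal \<Rightarrow> 'a measure \<Rightarrow> ('a \<Rightarrow> ennreal) \<Rightarrow> ennreal" where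
  "lp_norm p M g =
     (if p = \<infinity> then esssup M g
      else ennreal_powr (\<integral>\<^sup>+x. ennreal_powr (g x) (enn2real p) \<partial>M) (1 / enn2real p))"

definition littlewood_paley_pair ::
  "('a::euclidean_space \<Rightarrow> complex) \<Rightarrow> ('a \<Rightarrow> complex) \<Rightarrow> bool" where
  "littlewood_paley_pair \<phi>0 \<phi> \<longleftrightarrow>
     schwartz \<phi>0 \<and> schwartz \<phi> \<and>
     (\<forall>\<xi>. Im (fourier \<phi>0 \<xi>) = 0 \<and> Re (fourier \<phi>0 \<xi>) \<ge> 0) \<and>
     (\<forall>\<xi>. Im (fourier \<phi> \<xi>) = 0 \<and> Re (fourier \<phi> \<xi>) \<ge> 0) \<and>
     supp (fourier \<phi>0) \<subseteq> {\<xi>. norm \<xi> \<le> 2} \<and>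
     supp (fourier \<phi>) \<subseteq> {\<xi>. 1/2 \<le> norm \<xi> \<and> norm \<xi> \<le> 2} \<and>
     (\<exists>C>0. \<forall>\<xi>. norm \<xi> \<le> 5/3 \<longrightarrow> norm (fourier \<phi>0 \<xi>) \<ge> C) \<and>
     (\<exists>C>0. \<forall>\<xi>. 3/5 \<le> norm \<xi> \<and> norm \<xi> \<le> 5/3 \<longrightarrow> norm (fourier \<phi> \<xi>) \<ge> C)"

definition lp_piece ::
  "('a::euclidean_space \<Rightarrow> complex) \<Rightarrow> ('a \<Rightarrow> complex) \<Rightarrow> nat \<Rightarrow> 'a \<Rightarrow> complex" where
  "lp_piece \<phi>0 \<phi> j =
     (if j = 0 then \<phi>0 else (\<lambda>x. 2 ^ (j * DIM('a)) * \<phi> (2 ^ j *\<^sub>R x)))"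

text \<open>\<open>P\<close> ranges over the cubes \<open>dyadic_cube J K\<close>, for which \<open>j\<^sub>P = J\<close> and hence
  \<open>max {j\<^sub>P, 0} = nat J\<close>.\<close>

definition besov_type_norm ::
  "(real ^ 'n \<Rightarrow> complex) \<Rightarrow> (real ^ 'n \<Rightarrow> complex) \<Rightarrow> real \<Rightarrow> real \<Rightarrow> ennreal \<Rightarrow> ennreal \<Rightarrow>
     ((real ^ 'n \<Rightarrow> complex) \<Rightarrow> complex) \<Rightarrow> ennreal" where
  "besov_type_norm \<phi>0 \<phi> s \<tau> p q f =
     (SUP (J, K) \<in> UNIV.
        ennreal (measure lborel (dyadic_cube J K) powr (- \<tau>)) *
        lp_norm q (count_space {nat J..})
          (\<lambda>j. ennreal (2 powr (real j * s)) *
               lp_norm p (restrict_space lborel (dyadic_cube J K))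
                 (\<lambda>x. ennreal (norm (convolution (lp_piece \<phi>0 \<phi> j) f x)))))"

definition besov_type_space ::
  "(real ^ 'n \<Rightarrow> complex) \<Rightarrow> (real ^ 'n \<Rightarrow> complex) \<Rightarrow> real \<Rightarrow> real \<Rightarrow> ennreal \<Rightarrow> ennreal \<Rightarrow>
     ((real ^ 'n \<Rightarrow> complex) \<Rightarrow> complex) set" where
  "besov_type_space \<phi>0 \<phi> s \<tau> p q =
     {f. tempered_distribution f \<and> besov_type_norm \<phi>0 \<phi> s \<tau> p q f < \<infinity>}"


section \<open>Maximal regularity\<close>

text \<open>The tuples \<open>(s, \<tau>, p, q)\<close> occurring in dimension \<open>n\<close>.\<close>

definition max_regularity_params :: "nat \<Rightarrow> (real \<times> real \<times> ennreal \<times> ennreal) set" where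
  "max_regularity_params n =
     {(exponent_inverse p, \<tau>, p, \<infinity>) | p \<tau>.
        1 \<le> p \<and> 0 < \<tau> \<and> \<tau> \<le> (real n - 1) / real n * exponent_inverse p} \<union>
     {(real n * (exponent_inverse p - \<tau>), \<tau>, p, q) | p q \<tau>.
        1 \<le> p \<and> 1 \<le> q \<and> (real n - 1) / real n * exponent_inverse p < \<tau>}"

definition max_regularity ::
  "(real ^ 'n \<Rightarrow> complex) \<Rightarrow> (real ^ 'n \<Rightarrow> complex) \<Rightarrow> (real ^ 'n) set \<Rightarrow> bool" where
  "max_regularity \<phi>0 \<phi> E \<longleftrightarrow>
     (\<forall>(s, \<tau>, p, q) \<in> max_regularity_params CARD('n).
        indicator_distribution E \<in> besov_type_space \<phi>0 \<phi> s \<tau> p q)"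


section \<open>Wavelet systems\<close>

definition orthonormal_basis_L2 :: "'i set \<Rightarrow> ('i \<Rightarrow> 'a::euclidean_space \<Rightarrow> real) \<Rightarrow> bool" where
  "orthonormal_basis_L2 A F \<longleftrightarrow>
     (\<forall>i\<in>A. F i \<in> borel_measurable lborel \<and> integrable lborel (\<lambda>x. (F i x)\<^sup>2)) \<and>
     (\<forall>i\<in>A. \<forall>j\<in>A. (LINT x|lborel. F i x * F j x) = (if i = j then 1 else 0)) \<and>
     (\<forall>g. g \<in> borel_measurable lborel \<and> integrable lborel (\<lambda>x. (g x)\<^sup>2) \<longrightarrow>
        (\<forall>\<epsilon>>0. \<exists>S c. finite S \<and> S \<subseteq> A \<and>
           (LINT x|lborel. (g x - (\<Sum>i\<in>S. c i * F i x))\<^sup>2) < \<epsilon>))"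

definition dilate :: "nat \<Rightarrow> 'a::euclidean_space \<Rightarrow> ('a \<Rightarrow> real) \<Rightarrow> 'a \<Rightarrow> real" where
  "dilate j k g x = 2 powr (real (j * DIM('a)) / 2) * g (2 ^ j *\<^sub>R x - k)"

text \<open>An orthonormal scaling function \<open>\<phi>\<close> on the line and an associated wavelet \<open>\<psi>\<close>. The masks
  \<open>h\<close> and \<open>g\<close> in the two-scale relations are finite because of the compact supports.\<close>

definition scaling_wavelet_pair :: "(real \<Rightarrow> real) \<Rightarrow> (real \<Rightarrow> real) \<Rightarrow> bool" where
  "scaling_wavelet_pair \<phi> \<psi> \<longleftrightarrow>
     compact (supp \<phi>) \<and> compact (supp \<psi>) \<and>
     (\<exists>h::int \<Rightarrow> real. finite {k. h k \<noteq> 0} \<and>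
        (\<forall>x. \<phi> x = (\<Sum>k | h k \<noteq> 0. h k * dilate 1 (of_int k) \<phi> x))) \<and>
     (\<exists>g::int \<Rightarrow> real. finite {k. g k \<noteq> 0} \<and>
        (\<forall>x. \<psi> x = (\<Sum>k | g k \<noteq> 0. g k * dilate 1 (of_int k) \<phi> x))) \<and>
     orthonormal_basis_L2 (UNIV <+> UNIV)
       (case_sum (\<lambda>k::int. dilate 0 (of_int k) \<phi>) (\<lambda>(j, k::int). dilate j (of_int k) \<psi>))"

text \<open>The \<open>2 ^ n - 1\<close> mother wavelets are indexed by the non-empty sets \<open>I\<close> of coordinates, the
  coordinates in \<open>I\<close> carrying a factor \<open>\<psi>\<close> and the others a factor \<open>\<phi>\<close>; the empty
  set yields the scaling function.\<close>

definition tensor_wavelet ::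
  "(real \<Rightarrow> real) \<Rightarrow> (real \<Rightarrow> real) \<Rightarrow> 'n set \<Rightarrow> real ^ 'n \<Rightarrow> real" where
  "tensor_wavelet \<phi> \<psi> I x = (\<Prod>a\<in>UNIV. if a \<in> I then \<psi> (x $ a) else \<phi> (x $ a))"

definition wavelet ::
  "(real \<Rightarrow> real) \<Rightarrow> (real \<Rightarrow> real) \<Rightarrow> 'n set \<Rightarrow> nat \<Rightarrow> int ^ 'n \<Rightarrow> real ^ 'n \<Rightarrow> real" where
  "wavelet \<phi> \<psi> I j k = dilate j (\<chi> a. of_int (k $ a)) (tensor_wavelet \<phi> \<psi> I)"

definition wavelet_system ::
  "'n::finite itself \<Rightarrow> nat \<Rightarrow> (real \<Rightarrow> real) \<Rightarrow> (real \<Rightarrow> real) \<Rightarrow> bool" where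
  "wavelet_system (_ :: 'n itself) N1 \<phi> \<psi> \<longleftrightarrow>
     scaling_wavelet_pair \<phi> \<psi> \<and>
     (\<forall>I::'n set. Ck N1 (tensor_wavelet \<phi> \<psi> I) \<and> compact (supp (tensor_wavelet \<phi> \<psi> I))) \<and>
     orthonormal_basis_L2 (UNIV <+> {I. I \<noteq> {}} \<times> UNIV)
       (case_sum (\<lambda>k. wavelet \<phi> \<psi> ({} :: 'n set) 0 k) (\<lambda>(I, j, k). wavelet \<phi> \<psi> I j k)) \<and>
     (\<forall>(I::'n set) j k \<gamma>. I \<noteq> {} \<and> (\<Sum>a\<in>UNIV. \<gamma> a) \<le> N1 \<longrightarrow>
        (LINT x|lborel. wavelet \<phi> \<psi> I j k x * (\<Prod>a\<in>UNIV. (x $ a) ^ \<gamma> a)) = 0)"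

text \<open>A wavelet is only of class \<open>C\<^sup>N\<close>, so the bracket of a tempered distribution with it is the
  continuous extension of the distribution from smooth to \<open>C\<^sup>N\<close> functions with compact
  support. The following says that the extension exists and has value \<open>c\<close> at \<open>g\<close>. (Adding null
  sequences to an approximating sequence, one sees that the condition forces continuity of
  \<open>f\<close> in the \<open>C\<^sup>N\<close> topology on each compact set.)\<close>

definition has_bracket ::
  "nat \<Rightarrow> (('a::euclidean_space \<Rightarrow> complex) \<Rightarrow> complex) \<Rightarrow> ('a \<Rightarrow> real) \<Rightarrow> complex \<Rightarrow> bool" where
  "has_bracket N f g c \<longleftrightarrow>
     (\<forall>\<theta> K. compact K \<and> (\<forall>m k. Ck k (\<theta> m)) \<and> (\<forall>m. supp (\<theta> m) \<subseteq> K) \<and>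
        (\<forall>vs\<in>diff_ops N. uniform_limit UNIV (\<lambda>m::nat. iter_deriv vs (\<theta> m))
           (iter_deriv vs (\<lambda>x. complex_of_real (g x))) sequentially)
        \<longrightarrow> (\<lambda>m. f (\<theta> m)) \<longlonglongrightarrow> c)"

definition wavelet_coefficients ::
  "nat \<Rightarrow> (real \<Rightarrow> real) \<Rightarrow> (real \<Rightarrow> real) \<Rightarrow> ((real ^ 'n \<Rightarrow> complex) \<Rightarrow> complex) \<Rightarrow>
     (int ^ 'n \<Rightarrow> complex) \<Rightarrow> ('n set \<Rightarrow> nat \<Rightarrow> int ^ 'n \<Rightarrow> complex) \<Rightarrow> bool" where
  "wavelet_coefficients N1 \<phi> \<psi> f l0 l \<longleftrightarrow>
     (\<forall>k. has_bracket N1 f (wavelet \<phi> \<psi> {} 0 k) (l0 k)) \<and>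
     (\<forall>I j k. I \<noteq> {} \<longrightarrow> has_bracket N1 f (wavelet \<phi> \<psi> I j k) (l I j k))"

text \<open>The sum over \<open>j\<close> and the inner sum over the mother wavelets form one \<open>\<ell>\<^sup>q\<close>-norm over pairs
  \<open>(j, I)\<close>.\<close>

definition besov_type_seq_norm ::
  "real \<Rightarrow> real \<Rightarrow> ennreal \<Rightarrow> ennreal \<Rightarrow>
     (int ^ 'n \<Rightarrow> complex) \<Rightarrow> ('n set \<Rightarrow> nat \<Rightarrow> int ^ 'n \<Rightarrow> complex) \<Rightarrow> ennreal" where
  "besov_type_seq_norm s \<tau> p q l0 l =
     (SUP (J, K) \<in> {(J, K). measure lborel (dyadic_cube J K) \<ge> 1}.
        ennreal (measure lborel (dyadic_cube J K) powr (- \<tau>)) *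
        lp_norm p (count_space {m. dyadic_cube 0 m \<subseteq> dyadic_cube J K})
          (\<lambda>m. ennreal (norm (l0 m)))) +
     (SUP (J, K) \<in> UNIV.
        ennreal (measure lborel (dyadic_cube J K) powr (- \<tau>)) *
        lp_norm q (count_space ({nat J..} \<times> {I. I \<noteq> {}}))
          (\<lambda>(j, I).
             ennreal (2 powr (real j * (s + real CARD('n) / 2 - real CARD('n) * exponent_inverse p))) *
             lp_norm p (count_space {m. dyadic_cube (int j) m \<subseteq> dyadic_cube J K})
               (\<lambda>m. ennreal (norm (l I j m)))))"

definition wavelet_characterization ::
  "(real ^ 'n \<Rightarrow> complex) \<Rightarrow> (real ^ 'n \<Rightarrow> complex) \<Rightarrow> real \<Rightarrow> real \<Rightarrow> ennreal \<Rightarrow> ennreal \<Rightarrow>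
     nat \<Rightarrow> (real \<Rightarrow> real) \<Rightarrow> (real \<Rightarrow> real) \<Rightarrow> bool" where
  "wavelet_characterization \<phi>0 \<phi> s \<tau> p q N1 \<phi>w \<psi>w \<longleftrightarrow>
     (\<exists>c1>0. \<exists>c2>0. \<forall>f. tempered_distribution f \<longrightarrow>
        (besov_type_norm \<phi>0 \<phi> s \<tau> p q f < \<infinity> \<longrightarrow>
           (\<exists>l0 l. wavelet_coefficients N1 \<phi>w \<psi>w f l0 l)) \<and>
        (\<forall>l0 l. wavelet_coefficients N1 \<phi>w \<psi>w f l0 l \<longrightarrow>
           ennreal c1 * besov_type_seq_norm s \<tau> p q l0 l \<le> besov_type_norm \<phi>0 \<phi> s \<tau> p q f \<and>
           besov_type_norm \<phi>0 \<phi> s \<tau> p q f \<le> ennreal c2 * besov_type_seq_norm s \<tau> p q l0 l))"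

definition admissible_wavelet_system ::
  "(real ^ 'n \<Rightarrow> complex) \<Rightarrow> (real ^ 'n \<Rightarrow> complex) \<Rightarrow> real \<Rightarrow> real \<Rightarrow> ennreal \<Rightarrow> ennreal \<Rightarrow>
     nat \<Rightarrow> (real \<Rightarrow> real) \<Rightarrow> (real \<Rightarrow> real) \<Rightarrow> bool" where
  "admissible_wavelet_system \<phi>0 \<phi> s \<tau> p q N1 \<phi>w \<psi>w \<longleftrightarrow>
     wavelet_system TYPE('n) N1 \<phi>w \<psi>w \<and> wavelet_characterization \<phi>0 \<phi> s \<tau> p q N1 \<phi>w \<psi>w"

definition boundary_indices ::
  "(real \<Rightarrow> real) \<Rightarrow> (real \<Rightarrow> real) \<Rightarrow> (real ^ 'n) set \<Rightarrow> nat \<Rightarrow> (int ^ 'n) set" where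
  "boundary_indices \<phi> \<psi> E j =
     {r. \<exists>I. I \<noteq> {} \<and> supp (wavelet \<phi> \<psi> I j r) \<inter> frontier E \<noteq> {}}"

end

theory Submission
  imports Defs
begin

text \<open>By the wavelet characterization it suffices to bound the sequence norm of the coefficients
  \<open>\<integral>\<^sub>E \<psi>\<close> of \<open>\<one>\<^sub>E\<close>. A wavelet of generation \<open>j\<close> has mean value zero, so its coefficient vanishes when
  \<open>\<one>\<^sub>E\<close> is constant near its support, and otherwise it is of size at most a constant times
  \<open>2 powr (- j * n / 2)\<close> (\<open>indicator_coefficient_bound\<close>). A dyadic cube of generation \<open>l\<close> thus
  contributes, in generation \<open>j\<close>, at most a constant times \<open>2 ^ ((j - l) * (n - 1))\<close> non-zero
  coefficients (\<open>coefficient_count\<close>). Inserting both bounds into the sequence norm leaves a geometric series in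
  \<open>j - l\<close>, or a bounded sequence when \<open>q = \<infinity>\<close>, for the parameters in the definition of maximal
  regularity (\<open>besov_type_seq_norm_finite\<close>, \<open>max_regularity_params_decay\<close>).

  The count needs care. If \<open>\<partial>E\<close> misses the support of a wavelet, then \<open>\<one>\<^sub>E\<close> is constant on each component of
  the support, but it is not immediate that there is only one component, and hence that the coefficient
  vanishes. The proof bypasses the connectedness of supports. For a non-zero coefficient \<open>\<partial>E\<close>
  certainly meets the cube around the support. The point is that the boundary point found there lies
  in the support of some wavelet of the same generation, with an index at bounded distance. This
  holds because the integer translates of the support of the one-dimensional wavelet \<open>\<psi>\<close> cover the
  line (\<open>wavelet_translates_cover\<close>). Indeed, on a gap the translates of \<open>\<phi> (2 x)\<close> would be combinations
  of the translates of \<open>\<phi>\<close> alone, and comparing the lengths of the sequences involved shows that the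
  translates of \<open>\<phi>\<close> vanish there as well (\<open>scaling_translates_vanish\<close>); then the indicator function of a
  small cube over the gap would be a limit of combinations of wavelets of mean value zero with uniformly bounded
  supports, although its integral is positive (\<open>scaling_translates_no_gap\<close>). So every index with a
  non-zero coefficient is close to an index of a wavelet whose support meets \<open>\<partial>E\<close>
  (\<open>nonzero_coefficient_near_boundary_index\<close>), and the counting hypothesis applies to finitely many
  neighbouring cubes (\<open>card_near_indices\<close>).\<close>

section \<open>Indicator functions as distributions\<close>

lemma continuous_on_Ck: "Ck k f \<Longrightarrow> continuous_on UNIV f"
  by (cases k) (simp_all add: continuous_at_imp_continuous_on differentiable_imp_continuous_within)

lemma norm_set_integral_le:
  fixes f :: "'a \<Rightarrow> 'b::{banach, second_countable_topology}"
  assumes "A \<in> sets M" "emeasure M A < \<infinity>" "f \<in> borel_measurable M"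
    and bound: "\<And>x. x \<in> A \<Longrightarrow> norm (f x) \<le> B"
  shows "set_integrable M A f" "norm (LINT x:A|M. f x) \<le> B * measure M A"
proof -
  show int: "set_integrable M A f"
    unfolding set_integrable_def
    by (rule integrableI_bounded_set_indicator[where B = B]) (use assms in auto)
  have "norm (LINT x:A|M. f x) \<le> (LINT x|M. norm (indicat_real A x *\<^sub>R f x))"
    unfolding set_lebesgue_integral_def by (rule integral_norm_bound)
  also have "\<dots> \<le> (LINT x|M. B * indicat_real A x)"
    using assms int unfolding set_integrable_def
    by (intro integral_mono integrable_norm integrable_mult_right integrable_real_indicator)
       (auto simp: indicator_def)
  also have "\<dots> = B * measure M A"
    using assms by simp
  finally show "norm (LINT x:A|M. f x) \<le> B * measure M A" .
qed

lemma indicator_distribution_lborel: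
  assumes "E \<in> sets borel" "continuous_on UNIV \<eta>"
  shows "indicator_distribution E \<eta> = (LINT x:E|lborel. \<eta> x)"
  unfolding indicator_distribution_def set_lebesgue_integral_def
  using assms(1) borel_measurable_continuous_onI[OF assms(2)] by (intro integral_completion) simp

lemma norm_le_schwartz_norm:
  assumes "schwartz \<eta>"
  shows "norm (\<eta> x) \<le> schwartz_norm 0 \<eta>"
proof -
  have ops: "diff_ops 0 = {[] :: 'a list}"
    unfolding diff_ops_def by auto
  have "bounded (range \<eta>)"
  proof -
    have "\<forall>vs\<in>diff_ops 0. bounded (range (\<lambda>x. (1 + norm x) ^ 0 *\<^sub>R iter_deriv vs \<eta> x))"
      using assms unfolding schwartz_def by blast
    then show ?thesis
      by (simp add: ops)
  qed
  then obtain B where B: "\<And>x. norm (\<eta> x) \<le> B"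
    unfolding bounded_iff by auto
  have "norm (\<eta> x) = (\<lambda>(vs, x). (1 + norm x) ^ 0 * norm (iter_deriv vs \<eta> x)) ([], x)"
    by simp
  also have "\<dots> \<le> schwartz_norm 0 \<eta>"
    unfolding schwartz_norm_def ops
    by (rule cSUP_upper) (auto intro!: bdd_aboveI[where M = B] simp: B)
  finally show ?thesis .
qed

lemma emeasure_open_bounded:
  fixes E :: "'a::euclidean_space set"
  assumes "open E" "bounded E"
  shows "E \<in> sets lborel" "emeasure lborel E < \<infinity>"
  using assms emeasure_bounded_finite by auto

lemma tempered_indicator_distribution:
  fixes E :: "'a::euclidean_space set"
  assumes E: "open E" "bounded E"
  shows "tempered_distribution (indicator_distribution E)"
proof -
  have cont: "continuous_on UNIV \<eta>" if "schwartz \<eta>" for \<eta> :: "'a \<Rightarrow> complex"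
    using continuous_on_Ck[of 0 \<eta>] that unfolding schwartz_def by blast
  have meas: "\<eta> \<in> borel_measurable lborel" if "schwartz \<eta>" for \<eta> :: "'a \<Rightarrow> complex"
    using borel_measurable_continuous_onI[OF cont[OF that]] by simp
  have repr: "indicator_distribution E \<eta> = (LINT x:E|lborel. \<eta> x)" if "continuous_on UNIV \<eta>" for \<eta>
    by (rule indicator_distribution_lborel) (use that E(1) in simp_all)
  note bound = norm_set_integral_le[OF emeasure_open_bounded[OF E] meas norm_le_schwartz_norm]
  show ?thesis
    unfolding tempered_distribution_def
  proof (intro conjI allI impI exI)
    fix a and \<eta> \<theta> :: "'a \<Rightarrow> complex"
    assume "schwartz \<eta> \<and> schwartz \<theta>"
    then have \<eta>: "schwartz \<eta>" and \<theta>: "schwartz \<theta>" by auto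
    have "continuous_on UNIV (\<lambda>x. a * \<eta> x + \<theta> x)"
      by (intro continuous_on_add continuous_on_mult continuous_on_const cont \<eta> \<theta>)
    then show "indicator_distribution E (\<lambda>x. a * \<eta> x + \<theta> x)
        = a * indicator_distribution E \<eta> + indicator_distribution E \<theta>"
      using bound(1)[OF \<eta> \<eta>] bound(1)[OF \<theta> \<theta>]
      by (simp add: repr cont \<eta> \<theta> set_integral_add(2) set_integrable_mult_right)
  next
    fix \<eta> :: "'a \<Rightarrow> complex"
    assume \<eta>: "schwartz \<eta>"
    then show "norm (indicator_distribution E \<eta>) \<le> measure lborel E * schwartz_norm 0 \<eta>"
      using bound(2)[OF \<eta> \<eta>] by (simp add: repr cont mult.commute)
  qed
qed

text \<open>Uniform convergence on the bounded set \<open>E\<close> is all that the pairing with \<open>\<one>\<^sub>E\<close> needs, so the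
  abstract bracket is the integral over \<open>E\<close>.\<close>

lemma has_bracket_indicator_distribution:
  fixes E :: "'a::euclidean_space set" and g :: "'a \<Rightarrow> real"
  assumes E: "open E" "bounded E" and g: "continuous_on UNIV g"
  shows "has_bracket N (indicator_distribution E) g (of_real (LINT x:E|lborel. g x))"
  unfolding has_bracket_def
proof (intro allI impI, elim conjE)
  fix \<theta> :: "nat \<Rightarrow> 'a \<Rightarrow> complex" and K :: "'a set"
  assume smooth: "\<forall>m k. Ck k (\<theta> m)"
    and lim: "\<forall>vs\<in>diff_ops N. uniform_limit UNIV (\<lambda>m. iter_deriv vs (\<theta> m))
           (iter_deriv vs (\<lambda>x. complex_of_real (g x))) sequentially"
  let ?g = "\<lambda>x. complex_of_real (g x)"
  note fin = emeasure_open_bounded[OF E]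
  have cont\<theta>: "continuous_on UNIV (\<theta> m)" for m
    using continuous_on_Ck[of 0] smooth by blast
  have contg: "continuous_on UNIV ?g"
    using g by (intro continuous_intros)
  have meas: "(\<lambda>x. \<theta> m x - ?g x) \<in> borel_measurable lborel" for m
    using borel_measurable_continuous_onI[OF continuous_on_diff[OF cont\<theta>[of m] contg]] by simp
  have "uniform_limit UNIV \<theta> ?g sequentially"
    using bspec[OF lim, of "[]"] by (simp add: diff_ops_def)
  have set_int: "set_integrable lborel E f" if "continuous_on UNIV f" for f :: "'a \<Rightarrow> complex"
  proof -
    have "compact (f ` closure E)"
      using that E by (intro compact_continuous_image continuous_on_subset[OF that]) auto
    then have "bounded (f ` closure E)"
      by (rule compact_imp_bounded)
    then obtain B where "\<And>x. x \<in> closure E \<Longrightarrow> norm (f x) \<le> B"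
      unfolding bounded_iff by auto
    then have B: "\<And>x. x \<in> E \<Longrightarrow> norm (f x) \<le> B"
      using closure_subset[of E] by auto
    show ?thesis
      by (rule norm_set_integral_le(1)[OF fin _ B]) (use borel_measurable_continuous_onI[OF that] in auto)
  qed
  show "(\<lambda>m. indicator_distribution E (\<theta> m)) \<longlonglongrightarrow> of_real (LINT x:E|lborel. g x)"
  proof (rule tendstoI)
    fix e :: real assume "e > 0"
    define d where "d = e / (measure lborel E + 1)"
    have pos: "measure lborel E + 1 > 0"
      using measure_nonneg[of lborel E] by linarith
    then have "d > 0" using \<open>e > 0\<close> by (simp add: d_def)
    have "eventually (\<lambda>m. \<forall>x. dist (\<theta> m x) (?g x) < d) sequentially"
      using uniform_limitD[OF \<open>uniform_limit UNIV \<theta> ?g sequentially\<close> \<open>d > 0\<close>] by simp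
    then show "eventually (\<lambda>m. dist (indicator_distribution E (\<theta> m)) (of_real (LINT x:E|lborel. g x)) < e)
        sequentially"
    proof eventually_elim
      case (elim m)
      have "(complex_of_real (LINT x:E|lborel. g x)) = (LINT x:E|lborel. ?g x)"
        unfolding set_lebesgue_integral_def
        by (subst integral_complex_of_real[symmetric]) (simp add: scaleR_conv_of_real)
      then have "dist (indicator_distribution E (\<theta> m)) (of_real (LINT x:E|lborel. g x))
          = norm (LINT x:E|lborel. \<theta> m x - ?g x)"
        using E cont\<theta>[of m] set_int[OF cont\<theta>[of m]] set_int[OF contg]
        by (simp add: dist_norm indicator_distribution_lborel)
      also have "\<dots> \<le> d * measure lborel E"
        by (rule norm_set_integral_le(2)[OF fin meas]) (use elim in \<open>auto simp: dist_norm less_imp_le\<close>)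
      also have "\<dots> < d * (measure lborel E + 1)"
        using \<open>d > 0\<close> by simp
      also have "\<dots> = e"
        using pos by (simp add: d_def)
      finally show ?case .
    qed
  qed
qed


section \<open>Best approximation in an orthonormal system\<close>

definition square_integrable :: "('a::euclidean_space \<Rightarrow> real) \<Rightarrow> bool" where
  "square_integrable g \<longleftrightarrow> g \<in> borel_measurable lborel \<and> integrable lborel (\<lambda>x. (g x)\<^sup>2)"

lemma integrable_mult_square_integrable:
  assumes "square_integrable f" "square_integrable g"
  shows "integrable lborel (\<lambda>x. f x * g x)"
proof (rule Bochner_Integration.integrable_bound)
  show "integrable lborel (\<lambda>x. (f x)\<^sup>2 + (g x)\<^sup>2)"
    using assms by (auto simp: square_integrable_def)
  show "(\<lambda>x. f x * g x) \<in> borel_measurable lborel"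
    using assms by (auto simp: square_integrable_def)
  have "\<bar>a * b\<bar> \<le> a\<^sup>2 + b\<^sup>2" for a b :: real
    using sum_squares_bound[of "\<bar>a\<bar>" "\<bar>b\<bar>"] abs_ge_zero[of "a * b"]
    unfolding abs_mult power2_abs by linarith
  then show "AE x in lborel. norm (f x * g x) \<le> norm ((f x)\<^sup>2 + (g x)\<^sup>2)"
    by auto
qed

lemma square_integrable_sum:
  assumes "finite S" "\<And>i. i \<in> S \<Longrightarrow> square_integrable (F i)"
  shows "square_integrable (\<lambda>x. \<Sum>i\<in>S. c i * F i x)"
proof -
  have "(\<lambda>x. (\<Sum>i\<in>S. c i * F i x)\<^sup>2) = (\<lambda>x. \<Sum>i\<in>S. \<Sum>j\<in>S. (c i * c j) * (F i x * F j x))"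
    by (simp add: power2_eq_square sum_product algebra_simps)
  moreover have "integrable lborel (\<lambda>x. \<Sum>i\<in>S. \<Sum>j\<in>S. (c i * c j) * (F i x * F j x))"
    using assms by (intro Bochner_Integration.integrable_sum integrable_mult_right
        integrable_mult_square_integrable) auto
  moreover have "(\<lambda>x. \<Sum>i\<in>S. c i * F i x) \<in> borel_measurable lborel"
    using assms by (intro borel_measurable_sum borel_measurable_times borel_measurable_const)
      (simp add: square_integrable_def)
  ultimately show ?thesis
    by (simp add: square_integrable_def)
qed

lemma square_integrable_diff:
  assumes "square_integrable f" "square_integrable g"
  shows "square_integrable (\<lambda>x. f x - g x)"
proof -
  have "(\<lambda>x. (f x - g x)\<^sup>2) = (\<lambda>x. (f x)\<^sup>2 + (g x)\<^sup>2 - 2 * (f x * g x))"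
    by (auto simp: power2_eq_square algebra_simps)
  moreover have "(\<lambda>x. f x - g x) \<in> borel_measurable lborel"
    using assms by (intro borel_measurable_diff) (simp_all add: square_integrable_def)
  ultimately show ?thesis
    using assms integrable_mult_square_integrable[OF assms] by (simp add: square_integrable_def)
qed

lemma integral_square_diff_orthonormal:
  assumes g: "square_integrable g"
    and S: "finite S" "\<And>i. i \<in> S \<Longrightarrow> square_integrable (F i)"
    and ortho: "\<And>i j. i \<in> S \<Longrightarrow> j \<in> S \<Longrightarrow> (LINT x|lborel. F i x * F j x) = (if i = j then 1 else 0)"
  shows "(LINT x|lborel. (g x - (\<Sum>i\<in>S. c i * F i x))\<^sup>2)
    = (LINT x|lborel. (g x)\<^sup>2) - (\<Sum>i\<in>S. (LINT x|lborel. g x * F i x)\<^sup>2)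
      + (\<Sum>i\<in>S. (c i - (LINT x|lborel. g x * F i x))\<^sup>2)"
proof -
  let ?d = "\<lambda>i. LINT x|lborel. g x * F i x"
  have gF: "integrable lborel (\<lambda>x. g x * F i x)" if "i \<in> S" for i
    using g S that by (intro integrable_mult_square_integrable)
  have FF: "integrable lborel (\<lambda>x. F i x * F j x)" if "i \<in> S" "j \<in> S" for i j
    using S that by (intro integrable_mult_square_integrable)
  have "(LINT x|lborel. (g x - (\<Sum>i\<in>S. c i * F i x))\<^sup>2)
      = (LINT x|lborel. (g x)\<^sup>2 - 2 * (\<Sum>i\<in>S. c i * (g x * F i x))
          + (\<Sum>i\<in>S. \<Sum>j\<in>S. (c i * c j) * (F i x * F j x)))"
    by (intro Bochner_Integration.integral_cong refl)
       (simp add: power2_diff power2_eq_square[of "\<Sum>i\<in>S. c i * F i x" for x] sum_product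
         sum_distrib_left algebra_simps)
  also have "\<dots> = (LINT x|lborel. (g x)\<^sup>2) - 2 * (\<Sum>i\<in>S. c i * ?d i)
      + (\<Sum>i\<in>S. \<Sum>j\<in>S. (c i * c j) * (LINT x|lborel. F i x * F j x))"
    using g gF FF by (simp add: square_integrable_def)
  also have "(\<Sum>i\<in>S. \<Sum>j\<in>S. (c i * c j) * (LINT x|lborel. F i x * F j x)) = (\<Sum>i\<in>S. (c i)\<^sup>2)"
    using S(1) by (intro sum.cong refl)
      (simp add: ortho if_distrib[of "\<lambda>t. _ * t"] power2_eq_square cong: if_cong)
  finally show ?thesis
    by (simp add: power2_diff sum.distrib sum_subtractf sum_distrib_left algebra_simps)
qed

text \<open>Coefficients of an approximating finite combination may be replaced by Fourier coefficients,
  and indices with a vanishing Fourier coefficient may be dropped.\<close>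

lemma orthonormal_basis_L2_approx:
  assumes basis: "orthonormal_basis_L2 A F" and g: "square_integrable g" and "\<epsilon> > 0"
  obtains S where "finite S" "S \<subseteq> {i \<in> A. (LINT x|lborel. g x * F i x) \<noteq> 0}"
    "(LINT x|lborel. (g x - (\<Sum>i\<in>S. (LINT y|lborel. g y * F i y) * F i x))\<^sup>2) < \<epsilon>"
proof -
  let ?d = "\<lambda>i. LINT x|lborel. g x * F i x"
  obtain S c where S: "finite S" "S \<subseteq> A"
    and approx: "(LINT x|lborel. (g x - (\<Sum>i\<in>S. c i * F i x))\<^sup>2) < \<epsilon>"
    using basis g \<open>\<epsilon> > 0\<close> unfolding orthonormal_basis_L2_def square_integrable_def by blast
  define S' where "S' = {i \<in> S. ?d i \<noteq> 0}"
  have F: "square_integrable (F i)" if "i \<in> S" for i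
    using basis S that unfolding orthonormal_basis_L2_def square_integrable_def by blast
  have ortho: "(LINT x|lborel. F i x * F j x) = (if i = j then 1 else 0)" if "i \<in> S" "j \<in> S" for i j
    using basis S that unfolding orthonormal_basis_L2_def by blast
  have "(\<Sum>i\<in>S'. ?d i * F i x) = (\<Sum>i\<in>S. ?d i * F i x)" for x
    using S(1) unfolding S'_def by (intro sum.mono_neutral_left) auto
  then have "(LINT x|lborel. (g x - (\<Sum>i\<in>S'. ?d i * F i x))\<^sup>2)
      = (LINT x|lborel. (g x - (\<Sum>i\<in>S. ?d i * F i x))\<^sup>2)"
    by simp
  also have "\<dots> \<le> (LINT x|lborel. (g x - (\<Sum>i\<in>S. c i * F i x))\<^sup>2)"
    using integral_square_diff_orthonormal[OF g S(1) F ortho, of ?d]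
      integral_square_diff_orthonormal[OF g S(1) F ortho, of c]
      sum_nonneg[of S "\<lambda>i. (c i - ?d i)\<^sup>2"] by simp
  finally show ?thesis
    using S approx by (intro that[of S']) (auto simp: S'_def)
qed

lemma continuous_square_integral_zero:
  fixes h :: "'a::euclidean_space \<Rightarrow> real"
  assumes "continuous_on UNIV h" "square_integrable h" "(LINT x|lborel. (h x)\<^sup>2) = 0"
  shows "h x = 0"
proof (rule ccontr)
  assume "h x \<noteq> 0"
  have "AE x in lborel. (h x)\<^sup>2 = 0"
    using assms by (subst integral_nonneg_eq_0_iff_AE[symmetric]) (auto simp: square_integrable_def)
  then have ae: "AE x in lborel. \<not> h x \<noteq> 0"
    by simp
  have op: "open {x. h x \<noteq> 0}"
    using assms(1) by (intro open_Collect_neq continuous_on_const)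
  then have "{x. h x \<noteq> 0} \<in> null_sets lborel"
    using ae AE_iff_null_sets[of "{x. h x \<noteq> 0}" lborel] by simp
  then have "negligible {x. h x \<noteq> 0}"
    unfolding negligible_iff_null_sets by (rule null_sets_completionI)
  then show False
    using open_not_negligible[OF op] \<open>h x \<noteq> 0\<close> by auto
qed

text \<open>For a continuous function with finitely many non-zero Fourier coefficients the expansion
  holds at every point.\<close>

lemma finite_orthonormal_expansion:
  fixes g :: "'a::euclidean_space \<Rightarrow> real"
  assumes basis: "orthonormal_basis_L2 A F"
    and cont: "continuous_on UNIV g" "\<And>i. i \<in> A \<Longrightarrow> continuous_on UNIV (F i)"
    and g: "square_integrable g"
    and T: "finite T" "T \<subseteq> A" "\<And>i. i \<in> A \<Longrightarrow> i \<notin> T \<Longrightarrow> (LINT x|lborel. g x * F i x) = 0"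
  shows "g x = (\<Sum>i\<in>T. (LINT y|lborel. g y * F i y) * F i x)"
proof -
  let ?d = "\<lambda>i. LINT x|lborel. g x * F i x"
  have F: "square_integrable (F i)" if "i \<in> T" for i
    using basis T that unfolding orthonormal_basis_L2_def square_integrable_def by blast
  have ortho: "(LINT x|lborel. F i x * F j x) = (if i = j then 1 else 0)" if "i \<in> T" "j \<in> T" for i j
    using basis T that unfolding orthonormal_basis_L2_def by blast
  let ?h = "\<lambda>x. g x - (\<Sum>i\<in>T. ?d i * F i x)"
  have "(LINT x|lborel. (?h x)\<^sup>2) \<le> \<epsilon>" if pos: "\<epsilon> > 0" for \<epsilon>
  proof -
    obtain S where S: "finite S" "S \<subseteq> {i \<in> A. ?d i \<noteq> 0}"
      and approx: "(LINT x|lborel. (g x - (\<Sum>i\<in>S. ?d i * F i x))\<^sup>2) < \<epsilon>"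
      using orthonormal_basis_L2_approx[OF basis g pos] by blast
    then have "S \<subseteq> T"
      using T by blast
    let ?c = "\<lambda>i. if i \<in> S then ?d i else 0"
    have "(\<Sum>i\<in>S. ?d i * F i x) = (\<Sum>i\<in>T. ?c i * F i x)" for x
      using T(1) \<open>S \<subseteq> T\<close> by (intro sum.mono_neutral_cong_left) auto
    then have "(LINT x|lborel. (g x - (\<Sum>i\<in>T. ?c i * F i x))\<^sup>2) < \<epsilon>"
      using approx by simp
    moreover have "(\<Sum>i\<in>T. (?c i - ?d i)\<^sup>2) \<ge> 0"
      by (intro sum_nonneg) simp
    moreover have "(LINT x|lborel. (?h x)\<^sup>2)
        = (LINT x|lborel. (g x)\<^sup>2) - (\<Sum>i\<in>T. (?d i)\<^sup>2) + (\<Sum>i\<in>T. (?d i - ?d i)\<^sup>2)"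
      by (rule integral_square_diff_orthonormal[OF g T(1) F ortho])
    moreover have "(LINT x|lborel. (g x - (\<Sum>i\<in>T. ?c i * F i x))\<^sup>2)
        = (LINT x|lborel. (g x)\<^sup>2) - (\<Sum>i\<in>T. (?d i)\<^sup>2) + (\<Sum>i\<in>T. (?c i - ?d i)\<^sup>2)"
      by (rule integral_square_diff_orthonormal[OF g T(1) F ortho])
    moreover have "(\<Sum>i\<in>T. (?d i - ?d i)\<^sup>2) = 0"
      by simp
    ultimately show ?thesis
      by linarith
  qed
  then have "(LINT x|lborel. (?h x)\<^sup>2) \<le> 0"
    by (rule field_le_epsilon[of _ 0, simplified])
  moreover have "(LINT x|lborel. (?h x)\<^sup>2) \<ge> 0"
    by (intro integral_nonneg_AE) auto
  ultimately have "(LINT x|lborel. (?h x)\<^sup>2) = 0"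
    by simp
  moreover have "continuous_on UNIV ?h"
    using cont T(2)
    by (intro continuous_on_diff continuous_on_sum continuous_on_mult continuous_on_const) blast+
  moreover have "square_integrable ?h"
    by (intro square_integrable_diff square_integrable_sum g T F)
  ultimately have "?h x = 0"
    by (rule continuous_square_integral_zero[of ?h, rotated 2])
  then show ?thesis by simp
qed

text \<open>On a set of finite measure, convergence in the mean square implies convergence of the
  integrals; hence a mean value that vanishes for all basis functions involved vanishes for the
  limit.\<close>

lemma integral_zero_if_basis_mean_zero:
  fixes g :: "'a::euclidean_space \<Rightarrow> real"
  assumes basis: "orthonormal_basis_L2 A F" and g: "square_integrable g"
    and K: "K \<in> sets borel" "emeasure lborel K < \<infinity>" and supp_g: "\<And>x. x \<notin> K \<Longrightarrow> g x = 0"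
    and F: "\<And>i. i \<in> A \<Longrightarrow> (LINT x|lborel. g x * F i x) \<noteq> 0 \<Longrightarrow>
      (LINT x|lborel. F i x) = 0 \<and> (\<forall>x. x \<notin> K \<longrightarrow> F i x = 0)"
  shows "(LINT x|lborel. g x) = 0"
proof -
  let ?d = "\<lambda>i. LINT x|lborel. g x * F i x"
  have ind: "integrable lborel (indicat_real K)"
    using K by simp
  have int: "integrable lborel f"
    if "square_integrable f" "\<And>x. x \<notin> K \<Longrightarrow> f x = 0" for f :: "'a \<Rightarrow> real"
  proof (rule Bochner_Integration.integrable_bound)
    show "integrable lborel (\<lambda>x. (f x)\<^sup>2 + indicat_real K x)"
      using that ind by (auto simp: square_integrable_def)
    have "\<bar>a\<bar> \<le> a\<^sup>2 + 1" for a :: real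
      using sum_squares_bound[of "\<bar>a\<bar>" 1] by simp
    then show "AE x in lborel. norm (f x) \<le> norm ((f x)\<^sup>2 + indicat_real K x)"
      using that(2) by (auto simp: indicator_def)
  qed (use that in \<open>simp add: square_integrable_def\<close>)
  have bound: "\<bar>LINT x|lborel. g x\<bar> \<le> \<delta> * (1 + measure lborel K)" if pos: "\<delta> > 0" for \<delta>
  proof -
    obtain S where S: "finite S" "S \<subseteq> {i \<in> A. ?d i \<noteq> 0}"
      and approx: "(LINT x|lborel. (g x - (\<Sum>i\<in>S. ?d i * F i x))\<^sup>2) < \<delta>\<^sup>2"
      using orthonormal_basis_L2_approx[OF basis g zero_less_power[OF pos]] by blast
    let ?h = "\<lambda>x. g x - (\<Sum>i\<in>S. ?d i * F i x)"
    have sqF: "square_integrable (F i)" if "i \<in> S" for i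
      using basis S that unfolding orthonormal_basis_L2_def square_integrable_def by blast
    have F0: "F i x = 0" if "i \<in> S" "x \<notin> K" for i x
      using F S that by blast
    have h: "square_integrable ?h" "\<And>x. x \<notin> K \<Longrightarrow> ?h x = 0"
      using S(1) by (intro square_integrable_diff square_integrable_sum g sqF)
        (auto simp: supp_g F0)
    have "(LINT x|lborel. ?h x) = (LINT x|lborel. g x) - (\<Sum>i\<in>S. ?d i * (LINT x|lborel. F i x))"
      using int[OF g supp_g] int[OF sqF F0] by simp
    also have "\<dots> = (LINT x|lborel. g x)"
    proof -
      have "(\<Sum>i\<in>S. ?d i * (LINT x|lborel. F i x)) = 0"
      proof (intro sum.neutral ballI)
        fix i assume "i \<in> S"
        then have "i \<in> A" "?d i \<noteq> 0" using S(2) by auto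
        from F[OF this] show "?d i * (LINT x|lborel. F i x) = 0" by simp
      qed
      then show ?thesis by simp
    qed
    finally have "\<bar>LINT x|lborel. g x\<bar> \<le> (LINT x|lborel. \<bar>?h x\<bar>)"
      using integral_abs_bound[of lborel ?h] by simp
    (* The Cauchy-Schwarz inequality on K, in the form of a pointwise bound that balances both terms. *)
    also have "\<dots> \<le> (LINT x|lborel. (?h x)\<^sup>2 / \<delta> + \<delta> * indicat_real K x)"
    proof (rule integral_mono)
      show "integrable lborel (\<lambda>x. \<bar>?h x\<bar>)"
        by (intro integrable_abs int h)
      show "integrable lborel (\<lambda>x. (?h x)\<^sup>2 / \<delta> + \<delta> * indicat_real K x)"
        using h(1) ind unfolding square_integrable_def by (intro Bochner_Integration.integrable_add) auto
      fix x
      have "\<bar>a\<bar> \<le> a\<^sup>2 / \<delta> + \<delta>" for a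
      proof -
        have "\<bar>a\<bar> * \<delta> \<le> a\<^sup>2 + \<delta>\<^sup>2"
          using sum_squares_bound[of "\<bar>a\<bar>" \<delta>] mult_nonneg_nonneg[of "\<bar>a\<bar>" \<delta>] that
          unfolding power2_abs by linarith
        then show ?thesis
          using that by (simp add: field_simps power2_eq_square)
      qed
      then show "\<bar>?h x\<bar> \<le> (?h x)\<^sup>2 / \<delta> + \<delta> * indicat_real K x"
        using h(2)[of x] by (cases "x \<in> K") auto
    qed
    also have "\<dots> = (LINT x|lborel. (?h x)\<^sup>2) / \<delta> + \<delta> * measure lborel K"
      using h(1) ind K unfolding square_integrable_def by (subst Bochner_Integration.integral_add) auto
    also have "\<dots> \<le> \<delta>\<^sup>2 / \<delta> + \<delta> * measure lborel K"
      using approx that by (intro add_right_mono divide_right_mono) auto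
    finally show ?thesis
      using that by (simp add: power2_eq_square algebra_simps)
  qed
  have pos: "1 + measure lborel K > 0"
    using measure_nonneg[of lborel K] by linarith
  have "\<bar>LINT x|lborel. g x\<bar> \<le> \<epsilon>" if "\<epsilon> > 0" for \<epsilon>
    using bound[of "\<epsilon> / (1 + measure lborel K)"] pos that by simp
  then have "\<bar>LINT x|lborel. g x\<bar> \<le> 0"
    by (rule field_le_epsilon[of _ 0, simplified])
  then show ?thesis by simp
qed


section \<open>Translates of the wavelet cover the line\<close>

lemma not_zero_imp_supp: "f x \<noteq> 0 \<Longrightarrow> x \<in> supp f"
  unfolding supp_def using closure_subset by fastforce

lemma compact_supp_bound:
  fixes f :: "real \<Rightarrow> real"
  assumes "compact (supp f)"
  obtains R where "R > 0" "\<And>x. x \<in> supp f \<Longrightarrow> \<bar>x\<bar> \<le> R"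
  using compact_imp_bounded[OF assms] unfolding bounded_pos by auto

lemma dilate_real: "dilate j k f x = 2 powr (real j / 2) * f (2 ^ j * x - k)" for x :: real
  by (simp add: dilate_def)

lemma dilate_0_real: "dilate 0 k f x = f (x - k)" for x :: real
  by (simp add: dilate_real)

lemma dilate_Suc_real: "dilate (Suc j) k f x = sqrt 2 * dilate j k f (2 * x)" for x :: real
proof -
  have "2 powr (real (Suc j) / 2) = sqrt 2 * 2 powr (real j / 2)"
    by (simp add: powr_half_sqrt[symmetric] powr_add[symmetric] add_divide_distrib)
  then show ?thesis
    by (simp add: dilate_real algebra_simps)
qed

lemma dilate_1_shift: "dilate 1 (k + 2 * l) f x = dilate 1 k f (x - l)" for x :: real
  by (simp add: dilate_real algebra_simps)

lemma integral_dilate_Suc: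
  fixes f g :: "real \<Rightarrow> real"
  shows "(LINT x|lborel. dilate (Suc i) k f x * dilate (Suc j) l g x)
    = (LINT x|lborel. dilate i k f x * dilate j l g x)"
proof -
  have "(LINT x|lborel. dilate (Suc i) k f x * dilate (Suc j) l g x)
      = (LINT x|lborel. 2 * (dilate i k f (0 + 2 * x) * dilate j l g (0 + 2 * x)))"
    by (intro Bochner_Integration.integral_cong refl) (simp add: dilate_Suc_real)
  also have "\<dots> = 2 * (LINT x|lborel. (dilate i k f (0 + 2 * x) * dilate j l g (0 + 2 * x)))"
    by simp
  also have "\<dots> = (LINT x|lborel. dilate i k f x * dilate j l g x)"
    using lborel_integral_real_affine[of 2 "\<lambda>x. dilate i k f x * dilate j l g x" 0] by simp
  finally show ?thesis .
qed

lemma continuous_on_dilate: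
  fixes f :: "real \<Rightarrow> real"
  assumes "continuous_on UNIV f"
  shows "continuous_on UNIV (dilate j k f)"
  unfolding dilate_real[abs_def]
  by (intro continuous_intros continuous_on_compose2[OF assms]) auto

lemma square_integrable_dilate_1:
  fixes f :: "real \<Rightarrow> real"
  assumes "continuous_on UNIV f" "square_integrable (dilate 0 k f)"
  shows "square_integrable (dilate 1 k f)"
proof -
  have "integrable lborel (\<lambda>x. (dilate 0 k f (0 + 2 * x))\<^sup>2)"
    using assms(2) unfolding square_integrable_def
    by (intro lborel_integrable_real_affine[of "\<lambda>x. (dilate 0 k f x)\<^sup>2"]) auto
  then have "integrable lborel (\<lambda>x. 2 * (dilate 0 k f (2 * x))\<^sup>2)"
    by simp
  also have "(\<lambda>x. 2 * (dilate 0 k f (2 * x))\<^sup>2) = (\<lambda>x. (dilate 1 k f x)\<^sup>2)"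
    using dilate_Suc_real[of 0 k f] by (simp add: power_mult_distrib)
  finally show ?thesis
    using borel_measurable_continuous_onI[OF continuous_on_dilate[OF assms(1), of 1 k]]
    by (simp add: square_integrable_def)
qed

text \<open>The space spanned by the translates of \<open>\<phi> (2 x)\<close> is the sum of the spaces spanned by the
  translates of \<open>\<phi>\<close> and of \<open>\<psi>\<close>: rescaling shows that \<open>\<phi> (2 x - k)\<close> is orthogonal to all finer
  wavelets. Where all translates of \<open>\<psi>\<close> vanish, only those of \<open>\<phi>\<close> remain.\<close>

lemma scaling_function_reconstruction:
  fixes \<phi> \<psi> :: "real \<Rightarrow> real"
  assumes pair: "scaling_wavelet_pair \<phi> \<psi>"
    and cont: "continuous_on UNIV \<phi>" "continuous_on UNIV \<psi>"
  obtains h :: "int \<Rightarrow> real" where "finite {k. h k \<noteq> 0}"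
    "\<And>x. \<phi> x = (\<Sum>k | h k \<noteq> 0. h k * dilate 1 (of_int k) \<phi> x)"
    "\<And>x k. \<forall>l::int. \<psi> (x - of_int l) = 0 \<Longrightarrow>
      dilate 1 (of_int k) \<phi> x = (\<Sum>l | h (k - 2 * l) \<noteq> 0. h (k - 2 * l) * \<phi> (x - of_int l))"
proof -
  let ?F = "case_sum (\<lambda>k::int. dilate 0 (of_int k) \<phi>) (\<lambda>(j, k::int). dilate j (of_int k) \<psi>)"
  let ?A = "UNIV <+> UNIV :: (int + nat \<times> int) set"
  obtain h :: "int \<Rightarrow> real" where h: "finite {k. h k \<noteq> 0}"
    and scale: "\<And>x. \<phi> x = (\<Sum>k | h k \<noteq> 0. h k * dilate 1 (of_int k) \<phi> x)"
    using pair unfolding scaling_wavelet_pair_def by blast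
  have basis: "orthonormal_basis_L2 ?A ?F"
    using pair unfolding scaling_wavelet_pair_def by blast
  have ortho: "(LINT x|lborel. ?F i x * ?F j x) = (if i = j then 1 else 0)"
    and sq: "square_integrable (?F i)" if "i \<in> ?A" "j \<in> ?A" for i j
    using basis that unfolding orthonormal_basis_L2_def square_integrable_def by blast+
  have sq0: "square_integrable (dilate 0 (of_int k) \<phi>)" for k :: int
    using sq[of "Inl k" "Inl k"] by simp
  have sq1: "square_integrable (dilate 1 (of_int k) \<phi>)" for k :: int
    using square_integrable_dilate_1[OF cont(1) sq0] by simp
  have ortho1: "(LINT x|lborel. dilate 1 (of_int k) \<phi> x * dilate 1 (of_int l) \<phi> x)
      = (if k = l then 1 else 0)" for k l :: int
    using integral_dilate_Suc[of 0 "of_int k" \<phi> 0 "of_int l" \<phi>] ortho[of "Inl k" "Inl l"] by simp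
  obtain R1 where R1: "R1 > 0" "\<And>x. x \<in> supp \<phi> \<Longrightarrow> \<bar>x\<bar> \<le> R1"
    using compact_supp_bound pair unfolding scaling_wavelet_pair_def by blast
  obtain R2 where R2: "R2 > 0" "\<And>x. x \<in> supp \<psi> \<Longrightarrow> \<bar>x\<bar> \<le> R2"
    using compact_supp_bound pair unfolding scaling_wavelet_pair_def by blast
  have finh: "finite {l. h (k - 2 * l) \<noteq> 0}" for k
  proof -
    have "inj (\<lambda>l. k - 2 * l)"
      by (intro injI) simp
    then have "finite ((\<lambda>l. k - 2 * l) -` {k. h k \<noteq> 0})"
      using h by (intro finite_vimageI)
    then show ?thesis by (simp add: vimage_def)
  qed
  show ?thesis
  proof (rule that[OF h scale])
    fix x :: real and k :: int
    assume vanish: "\<forall>l::int. \<psi> (x - of_int l) = 0"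
    let ?g = "dilate 1 (of_int k) \<phi>"
    define M where "M = \<lceil>R2 + (R1 + \<bar>of_int k\<bar>) / 2\<rceil>"
    define T where "T = Inl ` {l. h (k - 2 * l) \<noteq> 0} \<union> Inr ` ({0 :: nat} \<times> {-M..M})"
    have dl: "(LINT y|lborel. ?g y * ?F (Inl l) y) = h (k - 2 * l)" for l
    proof -
      have "?g y * ?F (Inl l) y
          = (\<Sum>m | h m \<noteq> 0. h m * (?g y * dilate 1 (of_int (m + 2 * l)) \<phi> y))" for y
        using scale[of "y - of_int l"] dilate_1_shift[of _ "of_int l" \<phi> y]
        by (simp add: dilate_0_real sum_distrib_left mult.left_commute)
      then have "(LINT y|lborel. ?g y * ?F (Inl l) y)
          = (LINT y|lborel. (\<Sum>m | h m \<noteq> 0. h m * (?g y * dilate 1 (of_int (m + 2 * l)) \<phi> y)))"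
        by presburger
      also have "\<dots> = (\<Sum>m | h m \<noteq> 0. h m * (LINT y|lborel. ?g y * dilate 1 (of_int (m + 2 * l)) \<phi> y))"
        by (subst Bochner_Integration.integral_sum)
           (intro integrable_mult_right integrable_mult_square_integrable sq1, simp)
      also have "\<dots> = (\<Sum>m | h m \<noteq> 0. if m = k - 2 * l then h m else 0)"
        by (intro sum.cong refl) (subst ortho1, auto)
      also have "\<dots> = h (k - 2 * l)"
        using h by simp
      finally show ?thesis .
    qed
    have dr: "(LINT y|lborel. ?g y * ?F (Inr (j, l)) y) = 0" if "j \<noteq> 0 \<or> l \<notin> {-M..M}" for j l
    proof (cases j)
      case (Suc i)
      then show ?thesis
        using integral_dilate_Suc[of 0 "of_int k" \<phi> i "of_int l" \<psi>] ortho[of "Inl k" "Inr (i, l)"]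
        by simp
    next
      case 0
      have "?g y * ?F (Inr (j, l)) y = 0" for y
      proof (rule ccontr)
        assume "?g y * ?F (Inr (j, l)) y \<noteq> 0"
        then have "\<phi> (2 * y - of_int k) \<noteq> 0" "\<psi> (y - of_int l) \<noteq> 0"
          using 0 by (auto simp: dilate_real)
        then have "\<bar>2 * y - of_int k\<bar> \<le> R1" "\<bar>y - of_int l\<bar> \<le> R2"
          using R1 R2 not_zero_imp_supp by auto
        then have "\<bar>real_of_int l\<bar> \<le> R2 + (R1 + \<bar>of_int k\<bar>) / 2"
          by (simp add: field_simps)
        then have "\<bar>l\<bar> \<le> M"
          unfolding M_def by linarith
        then show False
          using that 0 by auto
      qed
      from Bochner_Integration.integral_cong[OF refl this] show ?thesis by simp
    qed
    have "?g x = (\<Sum>i\<in>T. (LINT y|lborel. ?g y * ?F i y) * ?F i x)"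
    proof (rule finite_orthonormal_expansion[OF basis])
      show "continuous_on UNIV ?g"
        by (rule continuous_on_dilate[OF cont(1)])
      show "continuous_on UNIV (?F i)" for i
        using continuous_on_dilate[OF cont(1)] continuous_on_dilate[OF cont(2)]
        by (cases i) auto
      show "square_integrable ?g" by (rule sq1)
      show "finite T" "T \<subseteq> ?A"
        unfolding T_def using finh by auto
      show "(LINT y|lborel. ?g y * ?F i y) = 0" if "i \<notin> T" for i
      proof (cases i)
        case (Inl l)
        then show ?thesis using dl[of l] that by (auto simp: T_def)
      next
        case (Inr p)
        obtain j l where "p = (j, l)"
          by (cases p)
        moreover from this have "j \<noteq> 0 \<or> l \<notin> {-M..M}"
          using that Inr by (auto simp: T_def image_iff)
        ultimately show ?thesis
          using dr Inr by blast
      qed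
    qed
    also have "\<dots> = (\<Sum>i\<in>Inl ` {l. h (k - 2 * l) \<noteq> 0}. (LINT y|lborel. ?g y * ?F i y) * ?F i x)"
      using finh vanish unfolding T_def
      by (intro sum.mono_neutral_right) (auto simp: dilate_0_real)
    also have "\<dots> = (\<Sum>l | h (k - 2 * l) \<noteq> 0. (LINT y|lborel. ?g y * ?F (Inl l) y) * ?F (Inl l) x)"
      by (subst sum.reindex) (simp_all add: o_def)
    also have "\<dots> = (\<Sum>l | h (k - 2 * l) \<noteq> 0. h (k - 2 * l) * \<phi> (x - of_int l))"
      by (simp only: dl, simp add: dilate_0_real)
    finally show "?g x = (\<Sum>l | h (k - 2 * l) \<noteq> 0. h (k - 2 * l) * \<phi> (x - of_int l))" .
  qed
qed

text \<open>The refinement equation halves the distance by which the support of \<open>\<phi>\<close> could exceed the convex hull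
  of the support of the mask, so there is no such excess.\<close>

lemma scaling_function_support:
  fixes \<phi> :: "real \<Rightarrow> real" and h :: "int \<Rightarrow> real"
  assumes "compact (supp \<phi>)" and h: "finite {k. h k \<noteq> 0}"
    and scale: "\<And>x. \<phi> x = (\<Sum>k | h k \<noteq> 0. h k * dilate 1 (of_int k) \<phi> x)"
    and "\<phi> x \<noteq> 0"
  shows "{k. h k \<noteq> 0} \<noteq> {}" "of_int (Min {k. h k \<noteq> 0}) \<le> x" "x \<le> of_int (Max {k. h k \<noteq> 0})"
proof -
  let ?S = "{x. \<phi> x \<noteq> 0}" and ?H = "{k. h k \<noteq> 0}"
  obtain R where "\<And>x. x \<in> supp \<phi> \<Longrightarrow> \<bar>x\<bar> \<le> R"
    using compact_supp_bound assms(1) by blast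
  then have "\<bar>y\<bar> \<le> R" if "y \<in> ?S" for y
    using that not_zero_imp_supp by auto
  then have bdd: "bdd_below ?S" "bdd_above ?S"
    by (auto intro!: bdd_belowI[of _ "- R"] bdd_aboveI[of _ R] simp: abs_le_iff minus_le_iff)
  have step: "\<exists>k\<in>?H. 2 * y - of_int k \<in> ?S" if y: "y \<in> ?S" for y
  proof (rule ccontr)
    assume "\<not> (\<exists>k\<in>?H. 2 * y - of_int k \<in> ?S)"
    then have "(\<Sum>k | h k \<noteq> 0. h k * dilate 1 (of_int k) \<phi> y) = 0"
      by (intro sum.neutral) (auto simp: dilate_real)
    then show False
      using y scale[of y] by simp
  qed
  have x: "x \<in> ?S"
    using assms by simp
  show "?H \<noteq> {}"
    using step[OF x] by blast
  have lower: "(Inf ?S + of_int (Min ?H)) / 2 \<le> y" and upper: "y \<le> (Sup ?S + of_int (Max ?H)) / 2"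
    if y: "y \<in> ?S" for y
  proof -
    obtain k where k: "k \<in> ?H" "2 * y - of_int k \<in> ?S"
      using step[OF y] by blast
    have "Inf ?S \<le> 2 * y - of_int k" "2 * y - of_int k \<le> Sup ?S"
      using k(2) bdd by (auto intro: cInf_lower cSup_upper)
    moreover have "real_of_int (Min ?H) \<le> of_int k" "real_of_int k \<le> of_int (Max ?H)"
      using h k(1) by (auto intro: Min_le Max_ge)
    ultimately show "(Inf ?S + of_int (Min ?H)) / 2 \<le> y" "y \<le> (Sup ?S + of_int (Max ?H)) / 2"
      by simp_all
  qed
  have "(Inf ?S + of_int (Min ?H)) / 2 \<le> Inf ?S"
    by (rule cInf_greatest[OF _ lower]) (use x in blast)
  then show "of_int (Min ?H) \<le> x"
    using cInf_lower[OF x bdd(1)] by simp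
  have "Sup ?S \<le> (Sup ?S + of_int (Max ?H)) / 2"
    by (rule cSup_least[OF _ upper]) (use x in blast)
  then show "x \<le> of_int (Max ?H)"
    using cSup_upper[OF x bdd(2)] by simp
qed

text \<open>Let \<open>D\<close> be the distance between the first and the last non-zero coefficient of the mask \<open>h\<close>. Then \<open>\<phi>\<close>
  vanishes outside an interval of length \<open>D\<close> with integer end points, so for \<open>2 x\<close> not an integer the
  non-zero entries of the sequence \<open>k \<mapsto> \<phi> (2 x - k)\<close> lie among at most \<open>D\<close> consecutive ones. If all
  translates of \<open>\<psi>\<close> vanish at \<open>x\<close>, this sequence arises from \<open>l \<mapsto> \<phi> (x - l)\<close> by upsampling and
  convolution with \<open>h\<close>; from a non-zero sequence that would produce two non-zero entries at a
  distance of at least \<open>D\<close>.\<close>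

lemma scaling_translates_vanish:
  fixes \<phi> \<psi> :: "real \<Rightarrow> real"
  assumes pair: "scaling_wavelet_pair \<phi> \<psi>"
    and cont: "continuous_on UNIV \<phi>" "continuous_on UNIV \<psi>"
    and vanish: "\<forall>l::int. \<psi> (x - of_int l) = 0" and nonint: "2 * x \<notin> \<int>"
  shows "\<phi> (x - of_int (l::int)) = 0"
proof (rule ccontr)
  assume nz: "\<phi> (x - of_int l) \<noteq> 0"
  obtain h where h: "finite {k. h k \<noteq> 0}"
    and scale: "\<And>x. \<phi> x = (\<Sum>k | h k \<noteq> 0. h k * dilate 1 (of_int k) \<phi> x)"
    and recon': "\<And>x k. \<forall>l::int. \<psi> (x - of_int l) = 0 \<Longrightarrow>
      dilate 1 (of_int k) \<phi> x = (\<Sum>l | h (k - 2 * l) \<noteq> 0. h (k - 2 * l) * \<phi> (x - of_int l))"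
    by (rule scaling_function_reconstruction[OF pair cont]) (rule that, assumption+)
  note recon = recon'[OF vanish]
  have "compact (supp \<phi>)"
    using pair unfolding scaling_wavelet_pair_def by blast
  note supp = scaling_function_support[OF this h scale]
  let ?H = "{k. h k \<noteq> 0}"
  define a b where "a = Min ?H" and "b = Max ?H"
  have ab: "h a \<noteq> 0" "h b \<noteq> 0" "\<And>k. h k \<noteq> 0 \<Longrightarrow> a \<le> k \<and> k \<le> b"
    using Min_in[OF h supp(1)[OF nz]] Max_in[OF h supp(1)[OF nz]] h unfolding a_def b_def by auto
  have in_ab: "of_int a \<le> y \<and> y \<le> of_int b" if "\<phi> y \<noteq> 0" for y
    using supp(2,3)[OF that] unfolding a_def b_def by blast
  define L where "L = {l::int. \<phi> (x - of_int l) \<noteq> 0}"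
  have "L \<subseteq> {\<lfloor>x\<rfloor> - b .. \<lceil>x\<rceil> - a}"
  proof
    fix l assume "l \<in> L"
    then have "of_int a \<le> x - of_int l \<and> x - of_int l \<le> of_int b"
      unfolding L_def using in_ab by blast
    then show "l \<in> {\<lfloor>x\<rfloor> - b .. \<lceil>x\<rceil> - a}"
      by simp linarith
  qed
  then have finL: "finite L"
    by (rule finite_subset) simp
  have "L \<noteq> {}"
    using nz unfolding L_def by blast
  define u v where "u = Min L" and "v = Max L"
  have uv: "u \<in> L" "v \<in> L" "\<And>l. l \<in> L \<Longrightarrow> u \<le> l \<and> l \<le> v"
    using finL \<open>L \<noteq> {}\<close> unfolding u_def v_def by auto
  (* At the two extreme indices exactly one term of the reconstruction sum is non-zero. *)
  have extreme: "\<phi> (2 * x - of_int k) \<noteq> 0"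
    if l0: "h (k - 2 * l0) \<noteq> 0" "l0 \<in> L" and unique: "\<And>l. l \<in> L \<Longrightarrow> h (k - 2 * l) \<noteq> 0 \<Longrightarrow> l = l0"
    for k l0
  proof -
    have zero: "\<phi> (x - of_int l) = 0" if "h (k - 2 * l) \<noteq> 0" "l \<noteq> l0" for l
      using unique[of l] that unfolding L_def by blast
    have "(\<Sum>l | h (k - 2 * l) \<noteq> 0. h (k - 2 * l) * \<phi> (x - of_int l))
        = (\<Sum>l\<in>{l0}. h (k - 2 * l) * \<phi> (x - of_int l))"
    proof (rule sum.mono_neutral_right)
      have "inj (\<lambda>l. k - 2 * l)"
        by (intro injI) simp
      then have "finite ((\<lambda>l. k - 2 * l) -` ?H)"
        using h by (intro finite_vimageI)
      then show "finite {l. h (k - 2 * l) \<noteq> 0}" by (simp add: vimage_def)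
    qed (use l0(1) zero in simp_all)
    then have "dilate 1 (of_int k) \<phi> x \<noteq> 0"
      using recon[of k] l0 unfolding L_def by simp
    then show ?thesis
      by (simp add: dilate_real)
  qed
  have "\<phi> (2 * x - of_int (b + 2 * v)) \<noteq> 0"
  proof (rule extreme)
    fix l assume "l \<in> L" "h (b + 2 * v - 2 * l) \<noteq> 0"
    then show "l = v"
      using uv(3)[of l] ab(3)[of "b + 2 * v - 2 * l"] by linarith
  qed (use ab uv in simp_all)
  then have 1: "of_int a \<le> 2 * x - of_int (b + 2 * v)"
    using in_ab by blast
  have "\<phi> (2 * x - of_int (a + 2 * u)) \<noteq> 0"
  proof (rule extreme)
    fix l assume "l \<in> L" "h (a + 2 * u - 2 * l) \<noteq> 0"
    then show "l = u"
      using uv(3)[of l] ab(3)[of "a + 2 * u - 2 * l"] by linarith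
  qed (use ab uv in simp_all)
  then have 2: "2 * x - of_int (a + 2 * u) \<le> of_int b"
    using in_ab by blast
  have "real_of_int u \<le> of_int v"
    using uv(3)[OF uv(1)] by simp
  then have "2 * x = of_int (a + b + 2 * u)"
    using 1 2 by simp
  then show False
    using nonint Ints_of_int by metis
qed

lemma scaling_function_nonzero:
  assumes "scaling_wavelet_pair \<phi> \<psi>"
  obtains c d where "\<phi> c \<noteq> 0" "\<psi> d \<noteq> 0"
proof -
  let ?F = "case_sum (\<lambda>k::int. dilate 0 (of_int k) \<phi>) (\<lambda>(j, k::int). dilate j (of_int k) \<psi>)"
  have "orthonormal_basis_L2 (UNIV <+> UNIV) ?F"
    using assms unfolding scaling_wavelet_pair_def by blast
  then have "\<forall>i\<in>UNIV <+> UNIV. (LINT x|lborel. ?F i x * ?F i x) = 1"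
    unfolding orthonormal_basis_L2_def by simp
  from bspec[OF this, of "Inl 0"] bspec[OF this, of "Inr (0, 0)"]
  have "(LINT x|lborel. \<phi> x * \<phi> x) = 1" "(LINT x|lborel. \<psi> x * \<psi> x) = 1"
    by (simp_all add: dilate_0_real)
  moreover have "\<exists>c. f c \<noteq> 0" if "(LINT x|lborel. f x * f x) = (1 :: real)" for f :: "real \<Rightarrow> real"
    using that by (cases "f = (\<lambda>_. 0)") auto
  ultimately show ?thesis
    using that by blast
qed

text \<open>Smoothness is only given for the tensor products; restricting them to a line parallel to an axis
  through a point with \<open>\<phi> \<noteq> 0\<close> recovers the factors.\<close>

lemma wavelet_system_continuous:
  assumes sys: "wavelet_system TYPE('n::finite) N1 \<phi> \<psi>"
  shows "continuous_on UNIV (tensor_wavelet \<phi> \<psi> (I :: 'n set))"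
    "continuous_on UNIV \<phi>" "continuous_on UNIV \<psi>"
proof -
  have cont: "continuous_on UNIV (tensor_wavelet \<phi> \<psi> I)" for I :: "'n set"
    using sys continuous_on_Ck unfolding wavelet_system_def by blast
  then show "continuous_on UNIV (tensor_wavelet \<phi> \<psi> I)" .
  have "scaling_wavelet_pair \<phi> \<psi>"
    using sys unfolding wavelet_system_def by blast
  then obtain c d where c: "\<phi> c \<noteq> 0" and "\<psi> d \<noteq> 0"
    by (rule scaling_function_nonzero)
  fix a0 :: 'n
  let ?L = "\<lambda>t. \<chi> a. if a = a0 then t else c"
  have "continuous_on UNIV (\<lambda>t. if a = a0 then t else c)" for a
    by (cases "a = a0") simp_all
  then have L: "continuous_on UNIV ?L"
    by (intro continuous_on_vec_lambda)
  have "tensor_wavelet \<phi> \<psi> {} (?L t) = \<phi> t * \<phi> c ^ (CARD('n) - 1)"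
    "tensor_wavelet \<phi> \<psi> {a0} (?L t) = \<psi> t * \<phi> c ^ (CARD('n) - 1)" for t
    unfolding tensor_wavelet_def
    by (subst prod.remove[of _ a0], simp, simp, simp add: card_Diff_singleton)+
  then have "\<phi> = (\<lambda>t. tensor_wavelet \<phi> \<psi> {} (?L t) / \<phi> c ^ (CARD('n) - 1))"
    "\<psi> = (\<lambda>t. tensor_wavelet \<phi> \<psi> {a0} (?L t) / \<phi> c ^ (CARD('n) - 1))"
    using c by auto
  moreover have "continuous_on UNIV (\<lambda>t. tensor_wavelet \<phi> \<psi> I (?L t) / \<phi> c ^ (CARD('n) - 1))" for I
    using c by (intro continuous_on_divide continuous_on_const continuous_on_compose2[OF cont L]) auto
  ultimately show "continuous_on UNIV \<phi>" "continuous_on UNIV \<psi>"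
    by metis+
qed

lemma open_avoid_half_integers:
  fixes U :: "real set"
  assumes "open U" "x \<in> U"
  obtains y where "y \<in> U" "2 * y \<notin> \<int>"
proof (cases "2 * x \<in> \<int>")
  case True
  obtain e where e: "e > 0" "ball x e \<subseteq> U"
    using assms openE by blast
  define d where "d = min (e / 2) (1 / 4)"
  have d: "0 < d" "d < e" "2 * d < 1"
    using e(1) by (auto simp: d_def)
  have "2 * (x + d) \<notin> \<int>"
  proof
    assume "2 * (x + d) \<in> \<int>"
    from Ints_diff[OF this True] have "2 * d \<in> \<int>"
      by simp
    then obtain n where "2 * d = of_int n"
      by (rule Ints_cases)
    then show False
      using d by simp
  qed
  moreover have "x + d \<in> U"
    using e(2) d by (auto simp: subset_eq dist_real_def)
  ultimately show ?thesis
    by (intro that)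
qed (use assms that in blast)

lemma wavelet_eq:
  "wavelet \<phi> \<psi> I j k x =
    2 powr (real (j * CARD('n)) / 2) *
    (\<Prod>a\<in>UNIV. if a \<in> I then \<psi> (2 ^ j * x $ a - of_int (k $ a)) else \<phi> (2 ^ j * x $ a - of_int (k $ a)))"
  for x :: "real ^ 'n"
  by (simp add: wavelet_def dilate_def tensor_wavelet_def cong: if_cong)

lemma wavelet_nonzero_bound:
  fixes x :: "real ^ 'n"
  assumes "\<forall>t. \<bar>t\<bar> > R \<longrightarrow> \<phi> t = 0 \<and> \<psi> t = 0" and "wavelet \<phi> \<psi> I j k x \<noteq> 0"
  shows "\<bar>2 ^ j * x $ a - of_int (k $ a)\<bar> \<le> R"
  using assms not_less unfolding wavelet_eq by (fastforce split: if_splits)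

lemma wavelet_support_radius:
  assumes "scaling_wavelet_pair \<phi> \<psi>"
  shows "\<exists>R>0. (\<forall>t. \<bar>t\<bar> > R \<longrightarrow> \<phi> t = 0 \<and> \<psi> t = 0) \<and> (\<forall>t\<in>supp \<psi>. \<bar>t\<bar> \<le> R)"
proof -
  obtain R1 where R1: "R1 > 0" "\<And>x. x \<in> supp \<phi> \<Longrightarrow> \<bar>x\<bar> \<le> R1"
    using compact_supp_bound assms unfolding scaling_wavelet_pair_def by blast
  obtain R2 where R2: "R2 > 0" "\<And>x. x \<in> supp \<psi> \<Longrightarrow> \<bar>x\<bar> \<le> R2"
    using compact_supp_bound assms unfolding scaling_wavelet_pair_def by blast
  show ?thesis
  proof (intro exI[of _ "max R1 R2"] conjI allI impI ballI)
    fix t :: real assume "\<bar>t\<bar> > max R1 R2"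
    then show "\<phi> t = 0" "\<psi> t = 0"
      using R1(2)[of t] R2(2)[of t] not_zero_imp_supp[of \<phi> t] not_zero_imp_supp[of \<psi> t] by auto
  next
    fix t assume "t \<in> supp \<psi>"
    then show "\<bar>t\<bar> \<le> max R1 R2"
      using R2(2)[of t] by simp
  qed (use R1(1) in simp)
qed

lemma continuous_on_wavelet:
  assumes "wavelet_system TYPE('n::finite) N1 \<phi> \<psi>"
  shows "continuous_on UNIV (wavelet \<phi> \<psi> (I :: 'n set) j k)"
  unfolding wavelet_def dilate_def
  by (intro continuous_on_mult continuous_on_const
      continuous_on_compose2[OF wavelet_system_continuous(1)[OF assms]]
      continuous_on_diff continuous_on_scaleR continuous_on_id) simp

lemma integral_wavelet_zero:
  fixes I :: "'n::finite set"
  assumes "wavelet_system TYPE('n) N1 \<phi> \<psi>" "I \<noteq> {}"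
  shows "(LINT x|lborel. wavelet \<phi> \<psi> I j k x) = 0"
proof -
  have "(LINT x|lborel. wavelet \<phi> \<psi> I j k x * (\<Prod>a\<in>UNIV. (x $ a) ^ \<gamma> a)) = 0"
    if "(\<Sum>a\<in>UNIV. \<gamma> a) \<le> N1" for \<gamma> :: "'n \<Rightarrow> nat"
    using assms that unfolding wavelet_system_def by blast
  from this[of "\<lambda>_. 0"] show ?thesis
    by simp
qed

text \<open>If all integer translates of \<open>\<phi>\<close> vanished near a point, then the indicator function of a
  small cube would be orthogonal to all translates of the scaling function, hence expand into
  wavelets alone, and its integral would vanish with theirs.\<close>

lemma scaling_translates_no_gap:
  assumes sys: "wavelet_system TYPE('n::finite) N1 \<phi> \<psi>"
    and "open U" "x \<in> U"
  shows "\<exists>y\<in>U. \<exists>k::int. \<phi> (y - of_int k) \<noteq> 0"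
proof (rule ccontr)
  assume "\<not> ?thesis"
  then have zero: "\<phi> (y - of_int k) = 0" if "y \<in> U" for y and k :: int
    using that by blast
  obtain e where e: "e > 0" "ball x e \<subseteq> U"
    using assms openE by blast
  let ?F = "case_sum (\<lambda>k. wavelet \<phi> \<psi> ({} :: 'n set) 0 k) (\<lambda>(I, j, k). wavelet \<phi> \<psi> I j k)"
  have basis: "orthonormal_basis_L2 (UNIV <+> {I. I \<noteq> {}} \<times> UNIV) ?F"
    using sys unfolding wavelet_system_def by blast
  have pair: "scaling_wavelet_pair \<phi> \<psi>"
    using sys unfolding wavelet_system_def by blast
  obtain R where R: "R > 0" "\<forall>t. \<bar>t\<bar> > R \<longrightarrow> \<phi> t = 0 \<and> \<psi> t = 0"
    using wavelet_support_radius[OF pair] by blast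
  define B where "B = box (\<chi> a. x - e) (\<chi> a::'n. x + e)"
  define K where "K = cbox (\<chi> a. x - e - 2 * R) (\<chi> a::'n. x + e + 2 * R)"
  have B_iff: "y \<in> B \<longleftrightarrow> (\<forall>a. y $ a \<in> ball x e)" for y
    by (auto simp: B_def mem_box_cart dist_real_def abs_less_iff less_diff_eq diff_less_eq
        algebra_simps)
  have fin: "emeasure lborel B < \<infinity>" "emeasure lborel K < \<infinity>"
    unfolding B_def K_def by (intro emeasure_bounded_finite bounded_box bounded_cbox)+
  have "(LINT y|lborel. indicat_real B y) = 0"
  proof (rule integral_zero_if_basis_mean_zero[OF basis])
    have "(\<lambda>y. (indicat_real B y)\<^sup>2) = indicat_real B"
      by (auto simp: indicator_def)
    then show "square_integrable (indicat_real B)"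
      using fin(1) by (simp add: square_integrable_def B_def)
    show "K \<in> sets borel" "emeasure lborel K < \<infinity>"
      using fin(2) by (simp_all add: K_def)
    show "indicat_real B y = 0" if "y \<notin> K" for y
    proof -
      have "x - e - 2 * R \<le> z \<and> z \<le> x + e + 2 * R" if "x - e < z \<and> z < x + e" for z
        using that R(1) by linarith
      then have "B \<subseteq> K"
        unfolding B_def K_def by (auto simp: mem_box_cart)
      then show ?thesis
        using that by (auto simp: indicator_def)
    qed
    fix i
    assume i: "i \<in> UNIV <+> {I. I \<noteq> {}} \<times> UNIV"
      and nz: "(LINT y|lborel. indicat_real B y * ?F i y) \<noteq> 0"
    from nz obtain y where y: "y \<in> B" "?F i y \<noteq> 0"
      by (metis (mono_tags, lifting) Bochner_Integration.integral_cong indicator_simps(2)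
          integral_zero mult_eq_0_iff)
    show "(LINT y|lborel. ?F i y) = 0 \<and> (\<forall>y. y \<notin> K \<longrightarrow> ?F i y = 0)"
    proof (cases i)
      case (Inl k)
      then have "\<phi> (y $ a - of_int (k $ a)) \<noteq> 0" for a
        using y(2) by (simp add: wavelet_eq)
      moreover have "y $ a \<in> U" for a
        using y(1) e(2) unfolding B_iff by blast
      ultimately show ?thesis
        using zero by blast
    next
      case (Inr p)
      obtain I j k where p: "p = (I, j, k)"
        by (cases p)
      then have "I \<noteq> {}"
        using i Inr by auto
      have "z \<in> K" if z: "wavelet \<phi> \<psi> I j k z \<noteq> 0" for z
      proof -
        have "z $ a \<ge> x - e - 2 * R \<and> z $ a \<le> x + e + 2 * R" for a
        proof -
          have "\<bar>2 ^ j * z $ a - of_int (k $ a)\<bar> \<le> R" "\<bar>2 ^ j * y $ a - of_int (k $ a)\<bar> \<le> R"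
            using wavelet_nonzero_bound[OF R(2)] z y(2) Inr p by auto
          then have "\<bar>2 ^ j * (z $ a - y $ a)\<bar> \<le> 2 * R"
            unfolding right_diff_distrib by linarith
          then have "2 ^ j * \<bar>z $ a - y $ a\<bar> \<le> 2 * R"
            by (simp add: abs_mult)
          moreover have "\<bar>z $ a - y $ a\<bar> \<le> 2 ^ j * \<bar>z $ a - y $ a\<bar>"
            using mult_right_mono[of 1 "2 ^ j" "\<bar>z $ a - y $ a\<bar>"] by simp
          moreover have "\<bar>x - y $ a\<bar> < e"
            using y(1) unfolding B_iff by (simp add: dist_real_def)
          ultimately show ?thesis
            by (auto simp: abs_less_iff abs_le_iff)
        qed
        then show ?thesis
          by (simp add: K_def mem_box_cart)
      qed
      moreover have "(LINT y|lborel. wavelet \<phi> \<psi> I j k y) = 0"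
        by (rule integral_wavelet_zero[OF sys \<open>I \<noteq> {}\<close>])
      ultimately show ?thesis
        using Inr p by auto
    qed
  qed
  then have "measure lborel B = 0"
    by (simp add: B_def)
  then have "emeasure lborel B = 0"
    using fin(1) by (simp add: emeasure_eq_ennreal_measure)
  then have "B \<in> null_sets lborel"
    unfolding B_def by (intro null_setsI) auto
  then have "negligible B"
    unfolding negligible_iff_null_sets by (rule null_sets_completionI)
  moreover have "(\<chi> a. x) \<in> B"
    using e(1) by (simp add: B_iff)
  ultimately show False
    using open_not_negligible[of B] unfolding B_def by auto
qed

text \<open>A gap in the translates of \<open>\<psi>\<close> would, away from half-integers, be a gap in those of \<open>\<phi>\<close>.\<close>

lemma wavelet_translates_cover:
  assumes sys: "wavelet_system TYPE('n::finite) N1 \<phi> \<psi>"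
  shows "\<exists>k::int. t - of_int k \<in> supp \<psi>"
proof (rule ccontr)
  assume gap: "\<nexists>k::int. t - of_int k \<in> supp \<psi>"
  have pair: "scaling_wavelet_pair \<phi> \<psi>"
    using sys unfolding wavelet_system_def by blast
  note cont = wavelet_system_continuous(2,3)[OF sys]
  obtain R where R: "\<And>t. \<bar>t\<bar> > R \<Longrightarrow> \<psi> t = 0"
    using wavelet_support_radius[OF pair] by blast
  define U where "U = ball t 1 \<inter> (\<Inter>k\<in>{\<lfloor>t - R - 1\<rfloor>..\<lceil>t + R + 1\<rceil>}. (\<lambda>y. y - of_int k) -` (- supp \<psi>))"
  have "open U"
    unfolding U_def
    by (intro open_Int open_ball open_INT finite_atLeastAtMost_int ballI open_vimage open_Compl
        continuous_on_diff continuous_on_id continuous_on_const) (simp add: supp_def)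
  have "t \<in> U"
    using gap unfolding U_def by auto
  have vanish: "\<psi> (y - of_int k) = 0" if "y \<in> U" for y and k :: int
  proof (cases "k \<in> {\<lfloor>t - R - 1\<rfloor>..\<lceil>t + R + 1\<rceil>}")
    case True
    then have "y - of_int k \<notin> supp \<psi>"
      using that unfolding U_def by blast
    then show ?thesis
      using not_zero_imp_supp by blast
  next
    case False
    have "\<bar>t - y\<bar> < 1"
      using that unfolding U_def by (simp add: dist_real_def)
    then have "\<bar>y - of_int k\<bar> > R"
      using False by (auto simp: not_le) linarith+
    then show ?thesis
      by (rule R)
  qed
  let ?U = "U \<inter> {y. 2 * y \<notin> \<int>}"
  have "open ?U"
  proof (intro open_Int \<open>open U\<close>)
    have "{y::real. 2 * y \<notin> \<int>} = (\<lambda>y. 2 * y) -` (- \<int>)"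
      by auto
    then show "open {y::real. 2 * y \<notin> \<int>}"
      by (simp add: open_vimage open_Compl closed_Ints continuous_on_mult_left)
  qed
  moreover obtain y where "y \<in> ?U"
    using open_avoid_half_integers[OF \<open>open U\<close> \<open>t \<in> U\<close>] by blast
  ultimately obtain z and k :: int where z: "z \<in> ?U" and nz: "\<phi> (z - of_int k) \<noteq> 0"
    using scaling_translates_no_gap[OF sys] by blast
  have "\<phi> (z - of_int k) = 0"
    using scaling_translates_vanish[OF pair cont, of z k] vanish z by blast
  then show False
    using nz by contradiction
qed


section \<open>Counting boundary indices\<close>

definition index_box :: "int \<Rightarrow> int ^ 'n \<Rightarrow> (int ^ 'n) set" where
  "index_box M c = {v. \<forall>a. \<bar>v $ a - c $ a\<bar> \<le> M}"

lemma index_box: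
  fixes c :: "int ^ 'n"
  assumes "M \<ge> 0"
  shows "finite (index_box M c)" "real (card (index_box M c)) \<le> (2 * real_of_int M + 1) ^ CARD('n)"
proof -
  let ?P = "PiE UNIV (\<lambda>a. {c $ a - M .. c $ a + M})"
  have "index_box M c \<subseteq> vec_lambda ` ?P"
  proof
    fix v assume "v \<in> index_box M c"
    then have "(\<lambda>a. v $ a) \<in> ?P"
      by (auto simp: index_box_def abs_le_iff diff_le_eq algebra_simps)
    then show "v \<in> vec_lambda ` ?P"
      by (metis image_eqI vec_nth_inverse)
  qed
  moreover have fin: "finite ?P"
    by (intro finite_PiE) auto
  ultimately show "finite (index_box M c)"
    using finite_subset by blast
  have "card (index_box M c) \<le> card ?P"
    using fin \<open>index_box M c \<subseteq> vec_lambda ` ?P\<close>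
    by (meson card_image_le card_mono finite_imageI le_trans)
  also have "\<dots> = nat (2 * M + 1) ^ CARD('n)"
    by (simp add: card_PiE algebra_simps)
  finally have "real (card (index_box M c)) \<le> real (nat (2 * M + 1) ^ CARD('n))"
    by (rule of_nat_mono)
  then show "real (card (index_box M c)) \<le> (2 * real_of_int M + 1) ^ CARD('n)"
    using assms by simp
qed

lemma mem_dyadic_cube:
  "x \<in> dyadic_cube (int j) r \<longleftrightarrow>
    (\<forall>a. of_int (r $ a) \<le> 2 ^ j * x $ a \<and> 2 ^ j * x $ a < of_int (r $ a) + 1)"
proof -
  have "2 powi (- int j) = (1 / 2 ^ j :: real)"
    by (simp add: power_int_minus divide_inverse)
  then show ?thesis
    unfolding dyadic_cube_def by (simp add: pos_divide_le_eq pos_less_divide_eq mult.commute)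
qed

lemma dyadic_cube_subset_iff:
  fixes r m :: "int ^ 'n"
  assumes "l \<le> j"
  shows "dyadic_cube (int j) r \<subseteq> dyadic_cube (int l) m \<longleftrightarrow> (\<forall>a. r $ a div 2 ^ (j - l) = m $ a)"
proof
  obtain d where j: "j = l + d"
    using assms le_iff_add by blast
  {
    assume sub: "dyadic_cube (int j) r \<subseteq> dyadic_cube (int l) m"
    have "(\<chi> a. of_int (r $ a) / 2 ^ j) \<in> dyadic_cube (int j) r"
      by (simp add: mem_dyadic_cube)
    then have in_l: "(\<chi> a. of_int (r $ a) / 2 ^ j) \<in> dyadic_cube (int l) m"
      using sub by blast
    show "\<forall>a. r $ a div 2 ^ (j - l) = m $ a"
    proof
      fix a
      have "real_of_int (m $ a) \<le> of_int (r $ a) / 2 ^ d" "of_int (r $ a) / 2 ^ d < real_of_int (m $ a) + 1"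
        using in_l by (auto simp: mem_dyadic_cube j power_add)
      then have "real_of_int (m $ a * 2 ^ d) \<le> of_int (r $ a)"
          "real_of_int (r $ a) < of_int ((m $ a + 1) * 2 ^ d)"
        by (simp_all add: pos_le_divide_eq pos_divide_less_eq)
      then have "m $ a * 2 ^ d \<le> r $ a" "r $ a < (m $ a + 1) * 2 ^ d"
        unfolding of_int_le_iff of_int_less_iff .
      then have "r $ a div 2 ^ d = m $ a"
        by (intro int_div_pos_eq[of _ _ _ "r $ a - m $ a * 2 ^ d"]) (auto simp: algebra_simps)
      then show "r $ a div 2 ^ (j - l) = m $ a"
        by (simp add: j)
    qed
  next
    assume div: "\<forall>a. r $ a div 2 ^ (j - l) = m $ a"
    show "dyadic_cube (int j) r \<subseteq> dyadic_cube (int l) m"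
    proof
      fix x assume x: "x \<in> dyadic_cube (int j) r"
      have "of_int (m $ a) \<le> 2 ^ l * x $ a \<and> 2 ^ l * x $ a < of_int (m $ a) + 1" for a
      proof -
        have "m $ a = r $ a div 2 ^ d"
          using div by (simp add: j)
        then have "r $ a = m $ a * 2 ^ d + r $ a mod 2 ^ d"
          using div_mult_mod_eq[of "r $ a" "2 ^ d"] by simp
        moreover have "0 \<le> r $ a mod 2 ^ d" "r $ a mod 2 ^ d + 1 \<le> 2 ^ d"
          using pos_mod_bound[of "2 ^ d" "r $ a"] by (simp_all add: add1_zle_eq)
        ultimately have "m $ a * 2 ^ d \<le> r $ a" "r $ a + 1 \<le> (m $ a + 1) * 2 ^ d"
          unfolding distrib_right by linarith+
        then have "real_of_int (m $ a * 2 ^ d) \<le> of_int (r $ a)"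
            "real_of_int (r $ a + 1) \<le> of_int ((m $ a + 1) * 2 ^ d)"
          unfolding of_int_le_iff .
        then have "of_int (m $ a) * 2 ^ d \<le> real_of_int (r $ a)"
            "real_of_int (r $ a) + 1 \<le> (of_int (m $ a) + 1) * 2 ^ d"
          by simp_all
        moreover have "of_int (r $ a) \<le> (2 ^ l * x $ a) * 2 ^ d" "(2 ^ l * x $ a) * 2 ^ d < of_int (r $ a) + 1"
          using x unfolding mem_dyadic_cube j power_add by (simp_all add: mult_ac)
        ultimately have "of_int (m $ a) * 2 ^ d \<le> (2 ^ l * x $ a) * 2 ^ d"
            "(2 ^ l * x $ a) * 2 ^ d < (of_int (m $ a) + 1) * (2 ^ d :: real)"
          by linarith+
        then show ?thesis
          by simp
      qed
      then show "x \<in> dyadic_cube (int l) m"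
        unfolding mem_dyadic_cube by blast
    qed
  }
qed

lemma abs_div_diff_le:
  fixes r r' M D :: int
  assumes "\<bar>r' - r\<bar> \<le> M" "D \<ge> 1"
  shows "\<bar>r' div D - r div D\<bar> \<le> M"
proof -
  have "M \<ge> 0" using assms(1) by simp
  then have "M * 1 \<le> M * D"
    using assms(2) by (intro mult_left_mono) auto
  then have "r' \<le> r + M * D" "r - M * D \<le> r'"
    using assms(1) by auto
  then have "r' div D \<le> (r + M * D) div D" "(r + (- M) * D) div D \<le> r' div D"
    using assms(2) by (intro zdiv_mono1; simp)+
  then show ?thesis
    using assms(2) div_mult_self1[of D r M] div_mult_self1[of D r "- M"] by (simp add: mult.commute)
qed

lemma card_Union_le:
  assumes "finite I" "\<And>i. i \<in> I \<Longrightarrow> finite (A i) \<and> real (card (A i)) \<le> b" "B \<subseteq> (\<Union>i\<in>I. A i)"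
    and "real (card I) \<le> c" "b \<ge> 0"
  shows "finite B" "real (card B) \<le> c * b"
proof -
  have "finite (\<Union>i\<in>I. A i)"
    using assms by blast
  then show "finite B"
    using assms(3) by (rule finite_subset[rotated])
  have "card B \<le> (\<Sum>i\<in>I. card (A i))"
    using card_mono[OF \<open>finite (\<Union>i\<in>I. A i)\<close> assms(3)] card_UN_le[OF assms(1), of A] by linarith
  then have "real (card B) \<le> (\<Sum>i\<in>I. real (card (A i)))"
    using of_nat_mono by fastforce
  also have "\<dots> \<le> real (card I) * b"
    using assms(2) by (intro sum_bounded_above) auto
  also have "\<dots> \<le> c * b"
    using assms(4,5) by (intro mult_right_mono)
  finally show "real (card B) \<le> c * b" .
qed

text \<open>Indices within distance \<open>M\<close> of a set \<open>\<Omega>\<close> obey the same counting bound as \<open>\<Omega>\<close>, up to a constant: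
  the cube containing a nearby index is one of boundedly many neighbours of the given cube.\<close>

lemma card_near_indices:
  fixes \<Omega> B :: "(int ^ 'n) set"
  assumes \<Omega>: "\<And>m :: int ^ 'n. real (card (\<Omega> \<inter> {r. \<forall>a. r $ a div D = m $ a})) \<le> b"
    and "D \<ge> 1" "M \<ge> 0"
    and centre: "\<And>r. r \<in> B \<Longrightarrow> \<exists>r'\<in>\<Omega>. r' \<in> index_box M r \<and> (\<chi> a. r' $ a div D) \<in> index_box M m"
  shows "finite B" "real (card B) \<le> (2 * real_of_int M + 1) ^ CARD('n) * (2 * real_of_int M + 1) ^ CARD('n) * b"
proof -
  let ?Q = "\<lambda>m :: int ^ 'n. {r. \<forall>a. r $ a div D = m $ a}"
  have finQ: "finite (?Q m)" for m
  proof -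
    have "r \<in> index_box D (\<chi> a. D * m $ a)" if r: "r \<in> ?Q m" for r
      unfolding index_box_def
    proof (intro CollectI allI)
      fix a
      have "D * m $ a + r $ a mod D = r $ a"
        using r mult_div_mod_eq[of D "r $ a"] by auto
      moreover have "0 \<le> r $ a mod D" "r $ a mod D < D"
        using \<open>D \<ge> 1\<close> by simp_all
      ultimately show "\<bar>r $ a - (\<chi> a. D * m $ a) $ a\<bar> \<le> D"
        by simp
    qed
    then have "?Q m \<subseteq> index_box D (\<chi> a. D * m $ a)"
      by blast
    moreover have "finite (index_box D (\<chi> a. D * m $ a))"
      using \<open>D \<ge> 1\<close> by (intro index_box) simp
    ultimately show ?thesis
      by (rule finite_subset)
  qed
  have b: "b \<ge> 0"
    using \<Omega>[of 0] by linarith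
  have inner: "finite (\<Union>r'\<in>\<Omega> \<inter> ?Q m'. index_box M r') \<and>
      real (card (\<Union>r'\<in>\<Omega> \<inter> ?Q m'. index_box M r')) \<le> b * (2 * real_of_int M + 1) ^ CARD('n)" for m'
  proof -
    have box: "finite (index_box M r') \<and> real (card (index_box M r')) \<le> (2 * real_of_int M + 1) ^ CARD('n)"
      for r' :: "int ^ 'n"
      using index_box[OF \<open>M \<ge> 0\<close>, of r'] by simp
    have fin: "finite (\<Omega> \<inter> ?Q m')"
      using finQ by blast
    have nonneg: "(2 * real_of_int M + 1) ^ CARD('n) \<ge> 0"
      using \<open>M \<ge> 0\<close> by simp
    note card_Union_le[where A = "index_box M", OF fin box subset_refl \<Omega> nonneg]
    then show ?thesis by blast
  qed
  have sub: "B \<subseteq> (\<Union>m'\<in>index_box M m. \<Union>r'\<in>\<Omega> \<inter> ?Q m'. index_box M r')"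
  proof
    fix r assume "r \<in> B"
    then obtain r' where r': "r' \<in> \<Omega>" "r' \<in> index_box M r" "(\<chi> a. r' $ a div D) \<in> index_box M m"
      using centre by blast
    then have "r \<in> index_box M r'"
      by (simp add: index_box_def abs_minus_commute)
    then show "r \<in> (\<Union>m'\<in>index_box M m. \<Union>r'\<in>\<Omega> \<inter> ?Q m'. index_box M r')"
      using r' by force
  qed
  have "b * (2 * real_of_int M + 1) ^ CARD('n) \<ge> 0"
    using b \<open>M \<ge> 0\<close> by simp
  note res = card_Union_le[OF index_box(1)[OF \<open>M \<ge> 0\<close>] inner sub index_box(2)[OF \<open>M \<ge> 0\<close>] this]
  show "finite B" by (rule res(1))
  show "real (card B) \<le> (2 * real_of_int M + 1) ^ CARD('n) * (2 * real_of_int M + 1) ^ CARD('n) * b"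
    using res(2) by (simp add: mult_ac)
qed


section \<open>Wavelet coefficients of an indicator function\<close>

definition indicator_coefficient ::
  "(real \<Rightarrow> real) \<Rightarrow> (real \<Rightarrow> real) \<Rightarrow> (real ^ 'n) set \<Rightarrow> 'n set \<Rightarrow> nat \<Rightarrow> int ^ 'n \<Rightarrow> real" where
  "indicator_coefficient \<phi> \<psi> E I j k = (LINT x:E|lborel. wavelet \<phi> \<psi> I j k x)"

text \<open>The cube that contains the supports of all wavelets of index \<open>(j, k)\<close> when \<open>\<phi>\<close> and \<open>\<psi>\<close> vanish outside
  \<open>[-R, R]\<close>. It stands in for the supports where connectedness matters.\<close>

definition wavelet_box :: "real \<Rightarrow> nat \<Rightarrow> int ^ 'n \<Rightarrow> (real ^ 'n) set" where
  "wavelet_box R j k = cbox (\<chi> a. (of_int (k $ a) - R) / 2 ^ j) (\<chi> a. (of_int (k $ a) + R) / 2 ^ j)"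

lemma mem_wavelet_box: "x \<in> wavelet_box R j k \<longleftrightarrow> (\<forall>a. \<bar>2 ^ j * x $ a - of_int (k $ a)\<bar> \<le> R)"
proof -
  have "u - R \<le> x * 2 ^ j \<and> x * 2 ^ j \<le> u + R \<longleftrightarrow> \<bar>2 ^ j * x - u\<bar> \<le> R" for x u :: real
    by (auto simp: abs_le_iff algebra_simps)
  then show ?thesis
    unfolding wavelet_box_def by (simp add: mem_box_cart pos_divide_le_eq pos_le_divide_eq)
qed

lemma content_wavelet_box:
  fixes k :: "int ^ 'n"
  assumes "R \<ge> 0"
  shows "measure lborel (wavelet_box R j k) = (2 * R) ^ CARD('n) / 2 ^ (j * CARD('n))"
proof -
  let ?a = "\<chi> a. (of_int (k $ a) - R) / 2 ^ j" and ?b = "\<chi> a. (of_int (k $ a) + R) / 2 ^ j"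
  have "?a \<in> cbox ?a ?b"
    using assms by (auto simp: mem_box_cart divide_right_mono)
  then have "measure lborel (cbox ?a ?b) = (\<Prod>a\<in>UNIV. ?b $ a - ?a $ a)"
    by (intro content_cbox_cart) auto
  also have "\<dots> = (\<Prod>a\<in>(UNIV :: 'n set). 2 * R / 2 ^ j)"
    by (intro prod.cong refl) (simp add: diff_divide_distrib[symmetric])
  finally show ?thesis
    by (simp add: wavelet_box_def power_divide power_mult)
qed

lemma tensor_factors_bounded:
  assumes "continuous_on UNIV f" "\<And>t. \<bar>t\<bar> > R \<Longrightarrow> f t = (0 :: real)"
  shows "\<exists>S\<ge>0. \<forall>t :: real. \<bar>f t\<bar> \<le> S"
proof -
  have "compact (f ` {- R..R})"
    by (intro compact_continuous_image continuous_on_subset[OF assms(1)]) auto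
  then have "bounded (f ` {- R..R})"
    by (rule compact_imp_bounded)
  then obtain S where S: "S > 0" "\<And>t. t \<in> {- R..R} \<Longrightarrow> \<bar>f t\<bar> \<le> S"
    unfolding bounded_pos by auto
  have "\<bar>f t\<bar> \<le> S" for t
  proof (cases "\<bar>t\<bar> > R")
    case True
    then show ?thesis using S(1) assms(2) by simp
  next
    case False
    then show ?thesis by (intro S(2)) auto
  qed
  then show ?thesis
    using S(1) by (intro exI[of _ S]) auto
qed

text \<open>The normalisation in \<open>L\<^sup>2\<close> gives a wavelet of generation \<open>j\<close> an amplitude of order
  \<open>2 powr (j * n / 2)\<close>, on a support of measure of order \<open>2 powr (- j * n)\<close>.\<close>

lemma indicator_coefficient_bound:
  fixes E :: "(real ^ 'n) set"
  assumes sys: "wavelet_system TYPE('n) N1 \<phi> \<psi>" and E: "open E" "bounded E"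
  shows "\<exists>A>0. \<forall>I j k. \<bar>indicator_coefficient \<phi> \<psi> E I j k\<bar> \<le> A * 2 powr (- (real (j * CARD('n)) / 2))"
proof -
  have pair: "scaling_wavelet_pair \<phi> \<psi>"
    using sys unfolding wavelet_system_def by blast
  obtain R where R: "R > 0" "\<forall>t. \<bar>t\<bar> > R \<longrightarrow> \<phi> t = 0 \<and> \<psi> t = 0"
    using wavelet_support_radius[OF pair] by blast
  obtain S1 where S1: "S1 \<ge> 0" "\<forall>t. \<bar>\<phi> t\<bar> \<le> S1"
    using tensor_factors_bounded[OF wavelet_system_continuous(2)[OF sys], of R] R(2) by blast
  obtain S2 where S2: "S2 \<ge> 0" "\<forall>t. \<bar>\<psi> t\<bar> \<le> S2"
    using tensor_factors_bounded[OF wavelet_system_continuous(3)[OF sys], of R] R(2) by blast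
  define S where "S = max S1 S2 + 1"
  have S: "S > 0" "\<bar>\<phi> t\<bar> \<le> S" "\<bar>\<psi> t\<bar> \<le> S" for t
    using S1 S2 by (auto simp: S_def intro: order_trans[of _ "S1"] order_trans[of _ "S2"])
  have "\<bar>indicator_coefficient \<phi> \<psi> E I j k\<bar> \<le> ((2 * R * S) ^ CARD('n)) * 2 powr (- (real (j * CARD('n)) / 2))"
    for I j k
  proof -
    let ?w = "wavelet \<phi> \<psi> I j k" and ?c = "2 powr (real (j * CARD('n)) / 2)"
    have w: "\<bar>?w x\<bar> \<le> ?c * S ^ CARD('n)" for x
    proof -
      have "(\<Prod>a\<in>UNIV. \<bar>if a \<in> I then \<psi> (2 ^ j * x $ a - of_int (k $ a)) else \<phi> (2 ^ j * x $ a - of_int (k $ a))\<bar>)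
          \<le> (\<Prod>a\<in>(UNIV :: 'n set). S)"
        using S by (intro prod_mono) auto
      then show ?thesis
        unfolding wavelet_eq by (simp add: abs_mult abs_prod)
    qed
    have zero: "?w x = 0" if "x \<notin> wavelet_box R j k" for x
      using wavelet_nonzero_bound[OF R(2)] that unfolding mem_wavelet_box by blast
    have sets: "E \<inter> wavelet_box R j k \<in> sets lborel" "emeasure lborel (E \<inter> wavelet_box R j k) < \<infinity>"
      using E emeasure_bounded_finite[OF bounded_subset[OF E(2), of "E \<inter> wavelet_box R j k"]]
      by (auto simp: wavelet_box_def)
    have "indicator_coefficient \<phi> \<psi> E I j k = (LINT x:(E \<inter> wavelet_box R j k)|lborel. ?w x)"
      unfolding indicator_coefficient_def set_lebesgue_integral_def
      by (intro Bochner_Integration.integral_cong refl) (auto simp: indicator_def zero)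
    also have "\<bar>\<dots>\<bar> \<le> ?c * S ^ CARD('n) * measure lborel (E \<inter> wavelet_box R j k)"
      using norm_set_integral_le(2)[OF sets, of ?w] w
        borel_measurable_continuous_onI[OF continuous_on_wavelet[OF sys]] by simp
    also have "\<dots> \<le> ?c * S ^ CARD('n) * measure lborel (wavelet_box R j k)"
    proof (intro mult_left_mono)
      show "measure lborel (E \<inter> wavelet_box R j k) \<le> measure lborel (wavelet_box R j k)"
        using sets(1) by (intro measure_mono_fmeasurable) (auto simp: wavelet_box_def)
    qed (use S in simp)
    also have "\<dots> = (2 * R * S) ^ CARD('n) * (?c / 2 ^ (j * CARD('n)))"
      using R(1) by (simp add: content_wavelet_box power_mult_distrib)
    also have "?c / 2 ^ (j * CARD('n)) = 2 powr (- (real (j * CARD('n)) / 2))"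
      by (simp add: powr_realpow[symmetric] powr_diff[symmetric] del: of_nat_mult)
    finally show ?thesis .
  qed
  moreover have "(2 * R * S) ^ CARD('n) > 0"
    using R(1) S(1) by simp
  ultimately show ?thesis
    by blast
qed

lemma mem_supp_tensor_wavelet:
  fixes z :: "real ^ 'n"
  assumes "\<And>a. 2 ^ j * z $ a - of_int (r $ a) \<in> supp \<psi>"
  shows "z \<in> supp (wavelet \<phi> \<psi> UNIV j r)"
  unfolding supp_def closure_approachable
proof (intro allI impI)
  fix e :: real assume "e > 0"
  define d where "d = e / CARD('n)"
  have d: "d > 0"
    using \<open>e > 0\<close> by (simp add: d_def)
  have "\<exists>t. \<psi> t \<noteq> 0 \<and> dist t (2 ^ j * z $ a - of_int (r $ a)) < d" for a
    using assms[of a] d unfolding supp_def closure_approachable by blast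
  then obtain t where t: "\<And>a. \<psi> (t a) \<noteq> 0" "\<And>a. dist (t a) (2 ^ j * z $ a - of_int (r $ a)) < d"
    by metis
  let ?y = "\<chi> a. (t a + of_int (r $ a)) / 2 ^ j"
  have "wavelet \<phi> \<psi> UNIV j r ?y \<noteq> 0"
    using t(1) by (simp add: wavelet_eq)
  moreover have "dist ?y z < e"
  proof -
    have close: "\<bar>(?y - z) $ a\<bar> < d" for a
    proof -
      have "\<bar>(?y - z) $ a\<bar> = \<bar>t a - (2 ^ j * z $ a - of_int (r $ a))\<bar> / 2 ^ j"
      proof -
        have "(?y - z) $ a = (t a - (2 ^ j * z $ a - of_int (r $ a))) / 2 ^ j"
          by (simp add: field_simps)
        then show ?thesis
          by (simp only: abs_divide) simp
      qed
      also have "\<dots> \<le> \<bar>t a - (2 ^ j * z $ a - of_int (r $ a))\<bar> / 1"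
        by (intro divide_left_mono) auto
      also have "\<dots> < d"
        using t(2)[of a] by (simp add: dist_real_def)
      finally show ?thesis .
    qed
    have "norm (?y - z) \<le> (\<Sum>a\<in>UNIV. \<bar>(?y - z) $ a\<bar>)"
      by (rule norm_le_l1_cart)
    also have "\<dots> < (\<Sum>a\<in>(UNIV :: 'n set). d)"
      using close by (intro sum_strict_mono) auto
    also have "\<dots> = e"
      by (simp add: d_def)
    finally show ?thesis
      by (simp add: dist_norm)
  qed
  ultimately show "\<exists>y\<in>{x. wavelet \<phi> \<psi> UNIV j r x \<noteq> 0}. dist y z < e"
    by blast
qed

text \<open>The coefficient vanishes if \<open>\<partial>E\<close> misses the cube around the support, since \<open>\<one>\<^sub>E\<close> is then constant on the
  cube, which is connected. Otherwise \<open>\<partial>E\<close> meets the cube, at a point that lies in the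
  support of another wavelet of the same generation, because these supports cover the space.\<close>

lemma nonzero_coefficient_near_boundary_index:
  fixes E :: "(real ^ 'n) set"
  assumes sys: "wavelet_system TYPE('n) N1 \<phi> \<psi>" and E: "open E"
    and R: "\<forall>t. \<bar>t\<bar> > R \<longrightarrow> \<phi> t = 0 \<and> \<psi> t = 0" "\<And>t. t \<in> supp \<psi> \<Longrightarrow> \<bar>t\<bar> \<le> R"
    and "I \<noteq> {}" and nz: "indicator_coefficient \<phi> \<psi> E I j r \<noteq> 0" and M: "2 * R \<le> of_int M"
  shows "\<exists>r'\<in>boundary_indices \<phi> \<psi> E j. r' \<in> index_box M r"
proof -
  let ?w = "wavelet \<phi> \<psi> I j r" and ?K = "wavelet_box R j r"
  have zero: "?w x = 0" if "x \<notin> ?K" for x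
    using wavelet_nonzero_bound[OF R(1)] that unfolding mem_wavelet_box by blast
  have "?K \<inter> E \<noteq> {}"
  proof
    assume "?K \<inter> E = {}"
    then have "?w x = 0" if "x \<in> E" for x
      using zero that by blast
    then have "(\<lambda>x. indicat_real E x *\<^sub>R ?w x) = (\<lambda>_. 0)"
      by (auto simp: indicator_def)
    then show False
      using nz unfolding indicator_coefficient_def set_lebesgue_integral_def by simp
  qed
  moreover have "?K - E \<noteq> {}"
  proof
    assume "?K - E = {}"
    then have "?w x = 0" if "x \<notin> E" for x
      using zero that by blast
    then have "indicator_coefficient \<phi> \<psi> E I j r = (LINT x|lborel. ?w x)"
      unfolding indicator_coefficient_def set_lebesgue_integral_def
      by (intro Bochner_Integration.integral_cong refl) (auto simp: indicator_def)
    then show False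
      using nz integral_wavelet_zero[OF sys \<open>I \<noteq> {}\<close>] by simp
  qed
  moreover have "connected ?K"
    unfolding wavelet_box_def by (intro convex_connected convex_box)
  ultimately obtain z where z: "z \<in> ?K" "z \<in> frontier E"
    using connected_Int_frontier by blast
  have "\<exists>k. \<forall>a. 2 ^ j * z $ a - of_int (k a) \<in> supp \<psi>"
    by (intro choice allI wavelet_translates_cover[OF sys])
  then obtain k :: "'n \<Rightarrow> int" where k: "\<And>a. 2 ^ j * z $ a - of_int (k a) \<in> supp \<psi>"
    by blast
  let ?r = "\<chi> a. k a"
  have "z \<in> supp (wavelet \<phi> \<psi> (UNIV :: 'n set) j ?r)"
    using k by (intro mem_supp_tensor_wavelet) simp
  then have "?r \<in> boundary_indices \<phi> \<psi> E j"
    using z(2) unfolding boundary_indices_def by blast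
  moreover have "\<bar>k a - r $ a\<bar> \<le> M" for a
  proof -
    have "\<bar>2 ^ j * z $ a - of_int (k a)\<bar> \<le> R" "\<bar>2 ^ j * z $ a - of_int (r $ a)\<bar> \<le> R"
      using R(2)[OF k] z(1) unfolding mem_wavelet_box by auto
    then have "\<bar>real_of_int (k a - r $ a)\<bar> \<le> of_int M"
      using M by simp
    then show ?thesis
      by linarith
  qed
  ultimately show ?thesis
    by (intro bexI[of _ ?r]) (simp_all add: index_box_def)
qed

lemma boundary_index_bound:
  fixes E :: "(real ^ 'n) set"
  assumes R: "\<forall>t. \<bar>t\<bar> > R \<longrightarrow> \<phi> t = 0 \<and> \<psi> t = 0"
    and E: "\<And>x. x \<in> E \<Longrightarrow> norm x \<le> \<rho>" and r: "r \<in> boundary_indices \<phi> \<psi> E j"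
  shows "\<bar>of_int (r $ a)\<bar> \<le> 2 ^ j * \<rho> + R"
proof -
  obtain I x where x: "x \<in> supp (wavelet \<phi> \<psi> I j r)" "x \<in> frontier E"
    using r unfolding boundary_indices_def by blast
  have "supp (wavelet \<phi> \<psi> I j r) \<subseteq> wavelet_box R j r"
    unfolding supp_def
  proof (rule closure_minimal)
    show "{x. wavelet \<phi> \<psi> I j r x \<noteq> 0} \<subseteq> wavelet_box R j r"
      using wavelet_nonzero_bound[OF R] by (auto simp: mem_wavelet_box)
  qed (simp only: wavelet_box_def closed_cbox)
  then have "x \<in> wavelet_box R j r"
    using x(1) by blast
  then have "\<bar>2 ^ j * x $ a - of_int (r $ a)\<bar> \<le> R"
    unfolding mem_wavelet_box by blast
  moreover have "closure E \<subseteq> cball 0 \<rho>"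
    using E by (intro closure_minimal) auto
  then have "norm x \<le> \<rho>"
    using x(2) unfolding frontier_def by auto
  then have "\<bar>x $ a\<bar> \<le> \<rho>"
    using component_le_norm_cart[of x a] by linarith
  then have "\<bar>2 ^ j * x $ a\<bar> \<le> 2 ^ j * \<rho>"
    by (simp add: abs_mult)
  ultimately show ?thesis
    by linarith
qed

text \<open>The counting hypothesis covers cubes up to the unit cube. Larger cubes are reduced to it because \<open>E\<close> is
  bounded: all boundary indices belong to a fixed finite number of unit cubes. The factor
  \<open>(2 * M + 1) ^ n\<close> enters the constant twice, once for neighbouring indices and once for neighbouring
  cubes.\<close>

lemma coefficient_count:
  fixes E :: "(real ^ 'n) set"
  assumes sys: "wavelet_system TYPE('n) N1 \<phi> \<psi>" and E: "open E" "bounded E"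
    and count: "\<And>(l::nat) (m :: int ^ 'n) (j::nat). l \<le> j \<Longrightarrow>
      real (card (boundary_indices \<phi> \<psi> E j \<inter> {r. dyadic_cube (int j) r \<subseteq> dyadic_cube (int l) m}))
        \<le> C * 2 ^ ((j - l) * (CARD('n) - 1))"
  shows "\<exists>N>0. (\<forall>J (K :: int ^ 'n) j I. nat J \<le> j \<longrightarrow> I \<noteq> {} \<longrightarrow>
        (let B = {r. dyadic_cube (int j) r \<subseteq> dyadic_cube J K \<and> indicator_coefficient \<phi> \<psi> E I j r \<noteq> 0}
         in finite B \<and> real (card B) \<le> N * 2 ^ ((j - nat J) * (CARD('n) - 1)))) \<and>
      (let B = {r. indicator_coefficient \<phi> \<psi> E {} 0 r \<noteq> 0} in finite B \<and> real (card B) \<le> N)"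
proof -
  let ?\<Omega> = "boundary_indices \<phi> \<psi> E"
  have pair: "scaling_wavelet_pair \<phi> \<psi>"
    using sys unfolding wavelet_system_def by blast
  obtain R where R: "R > 0" "\<forall>t. \<bar>t\<bar> > R \<longrightarrow> \<phi> t = 0 \<and> \<psi> t = 0"
      "\<And>t. t \<in> supp \<psi> \<Longrightarrow> \<bar>t\<bar> \<le> R"
    using wavelet_support_radius[OF pair] by blast
  obtain \<rho> where \<rho>: "\<rho> > 0" "\<And>x. x \<in> E \<Longrightarrow> norm x \<le> \<rho>"
    using E(2) unfolding bounded_pos by blast
  (* 2 R bounds the distance of two indices whose wavelet boxes meet; R + \<rho> bounds the boundary
     indices in units of the unit cube. *)
  define M where "M = \<lceil>2 * R + \<rho>\<rceil>"
  have M: "2 * R + \<rho> \<le> of_int M" "M \<ge> 0"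
    using R(1) \<rho>(1) unfolding M_def by linarith+
  let ?c = "(2 * real_of_int M + 1) ^ CARD('n)"
  have c: "?c \<ge> 1"
    using M(2) by (intro one_le_power) simp
  define N where "N = ?c * ?c * max C 1"
  have "?c \<le> ?c * ?c"
    using mult_left_mono[OF c, of ?c] c by linarith
  also have "\<dots> \<le> N"
    unfolding N_def using mult_left_mono[of 1 "max C 1" "?c * ?c"] by simp
  finally have N: "?c \<le> N" .
  have main: "finite B \<and> real (card B) \<le> N * 2 ^ ((j - nat J) * (CARD('n) - 1))"
    if "nat J \<le> j" "I \<noteq> {}"
      and B: "B = {r. dyadic_cube (int j) r \<subseteq> dyadic_cube J K \<and> indicator_coefficient \<phi> \<psi> E I j r \<noteq> 0}"
    for J and K :: "int ^ 'n" and j and I :: "'n set" and B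
  proof -
    define D where "D = (2 :: int) ^ (j - nat J)"
    define b where "b = max C 1 * 2 ^ ((j - nat J) * (CARD('n) - 1))"
    have D: "D \<ge> 1"
      by (simp add: D_def)
    have near: "\<exists>r'\<in>?\<Omega> j. r' \<in> index_box M r" if "r \<in> B" for r
      using that B R(1) \<rho>(1) M(1)
      by (intro nonzero_coefficient_near_boundary_index[OF sys E(1) R(2,3) \<open>I \<noteq> {}\<close>]) auto
    have \<Omega>: "real (card (?\<Omega> j \<inter> {r. \<forall>a. r $ a div D = m $ a})) \<le> b" for m
    proof -
      have "real (card (?\<Omega> j \<inter> {r. \<forall>a. r $ a div D = m $ a})) \<le> C * 2 ^ ((j - nat J) * (CARD('n) - 1))"
        using count[OF \<open>nat J \<le> j\<close>, of m] unfolding dyadic_cube_subset_iff[OF \<open>nat J \<le> j\<close>] D_def .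
      also have "\<dots> \<le> b"
        unfolding b_def by (intro mult_right_mono) auto
      finally show ?thesis .
    qed
    (* For a cube larger than the unit cube, all boundary indices lie in boundedly many unit cubes
       around the origin. *)
    define m where "m = (if J \<ge> 0 then K else 0)"
    have centre: "\<exists>r'\<in>?\<Omega> j. r' \<in> index_box M r \<and> (\<chi> a. r' $ a div D) \<in> index_box M m" if "r \<in> B" for r
    proof -
      obtain r' where r': "r' \<in> ?\<Omega> j" "r' \<in> index_box M r"
        using near[OF \<open>r \<in> B\<close>] by blast
      have "\<bar>r' $ a div D - m $ a\<bar> \<le> M" for a
      proof (cases "J \<ge> 0")
        case True
        then have "dyadic_cube (int j) r \<subseteq> dyadic_cube (int (nat J)) K"
          using \<open>r \<in> B\<close> B by simp
        then have "r $ a div D = K $ a"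
          unfolding dyadic_cube_subset_iff[OF \<open>nat J \<le> j\<close>] D_def by blast
        then show ?thesis
          using abs_div_diff_le[of "r' $ a" "r $ a" M D] r'(2) D True
          by (simp add: m_def index_box_def)
      next
        case False
        then have D': "D = 2 ^ j"
          by (simp add: D_def)
        have "\<bar>real_of_int (r' $ a)\<bar> \<le> 2 ^ j * \<rho> + 1 * R"
          using boundary_index_bound[OF R(2) \<rho>(2) r'(1)] by simp
        also have "\<dots> \<le> 2 ^ j * \<rho> + 2 ^ j * R"
          using R(1) by (intro add_left_mono mult_right_mono) auto
        also have "\<dots> \<le> 2 ^ j * of_int M"
          using M(1) R(1) unfolding distrib_left[symmetric] by (intro mult_left_mono) auto
        finally have "\<bar>real_of_int (r' $ a)\<bar> \<le> of_int (M * D)"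
          by (simp add: D' mult.commute)
        then have "\<bar>r' $ a\<bar> \<le> M * D"
          by linarith
        then show ?thesis
          using abs_div_diff_le[of "r' $ a" 0 "M * D" D] D False
            zdiv_mono1[of "r' $ a" "M * D" D] zdiv_mono1[of "(- M) * D" "r' $ a" D]
            nonzero_mult_div_cancel_right[of D M] nonzero_mult_div_cancel_right[of D "- M"]
          by (simp add: m_def abs_le_iff)
      qed
      then show ?thesis
        using r' by (intro bexI[of _ r']) (auto simp: index_box_def)
    qed
    note res = card_near_indices[OF \<Omega> D M(2) centre]
    have "real (card B) \<le> ?c * ?c * b"
      using res(2) by simp
    then show ?thesis
      using res(1) by (simp add: N_def b_def mult.assoc)
  qed
  have low: "finite B \<and> real (card B) \<le> N"
    if B: "B = {r. indicator_coefficient \<phi> \<psi> E {} 0 r \<noteq> 0}" for B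
  proof -
    have "B \<subseteq> index_box M 0"
    proof
      fix r assume "r \<in> B"
      then have "(LINT x:E|lborel. wavelet \<phi> \<psi> {} 0 r x) \<noteq> 0"
        unfolding B indicator_coefficient_def by blast
      then obtain x where x: "x \<in> E" "wavelet \<phi> \<psi> {} 0 r x \<noteq> 0"
        unfolding set_lebesgue_integral_def
        by (metis (mono_tags, lifting) Bochner_Integration.integral_cong indicator_simps(2)
            integral_zero scaleR_eq_0_iff)
      have "\<bar>r $ a\<bar> \<le> M" for a
      proof -
        have "\<bar>2 ^ 0 * x $ a - of_int (r $ a)\<bar> \<le> R"
          by (rule wavelet_nonzero_bound[OF R(2) x(2)])
        moreover have "\<bar>x $ a\<bar> \<le> \<rho>"
          using component_le_norm_cart[of x a] \<rho>(2)[OF x(1)] by linarith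
        ultimately have "\<bar>real_of_int (r $ a)\<bar> \<le> of_int M"
          using M(1) R(1) by simp
        then show ?thesis
          by linarith
      qed
      then show "r \<in> index_box M 0"
        by (simp add: index_box_def)
    qed
    then have "finite B" "card B \<le> card (index_box M (0 :: int ^ 'n))"
      using index_box(1)[OF M(2), of "0 :: int ^ 'n"] finite_subset card_mono by blast+
    moreover have "real (card (index_box M (0 :: int ^ 'n))) \<le> ?c"
      using index_box(2)[OF M(2), of "0 :: int ^ 'n"] by simp
    ultimately show ?thesis
      using N by linarith
  qed
  show ?thesis
    using main low N c unfolding Let_def by (intro exI[of _ N]) auto
qed


section \<open>Estimates in sequence spaces\<close>

lemma ennreal_powr_mono:
  assumes "x \<le> y" "a \<ge> 0"
  shows "ennreal_powr x a \<le> ennreal_powr y a"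
proof (cases "y = \<infinity>")
  case False
  then have "x < \<infinity>" "enn2real x \<le> enn2real y"
    using assms(1) by (auto intro!: enn2real_mono simp: less_top top.not_eq_extremum)
  then show ?thesis
    using False assms(2) by (auto simp: ennreal_powr_def intro!: ennreal_leI powr_mono2)
qed (simp add: ennreal_powr_def)

lemma ennreal_powr_ennreal: "x \<ge> 0 \<Longrightarrow> ennreal_powr (ennreal x) a = ennreal (x powr a)"
  by (simp add: ennreal_powr_def)

lemma exponent_cases:
  assumes "1 \<le> p"
  obtains "p = \<infinity>" "exponent_inverse p = 0"
    | r where "p = ennreal r" "r \<ge> 1" "p \<noteq> \<infinity>" "enn2real p = r" "exponent_inverse p = 1 / r"
proof (cases p)
  case top
  then show ?thesis using that(1) by (simp add: exponent_inverse_def)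
next
  case (real r)
  then have "r \<ge> 1"
    using assms by (simp add: one_ennreal.rep_eq flip: ennreal_1)
  then have "exponent_inverse p = 1 / r"
    using real by (simp add: exponent_inverse_def inverse_ennreal divide_inverse)
  then show ?thesis
    using real \<open>r \<ge> 1\<close> that(2)[of r] by simp
qed

lemma esssup_count_space_le:
  fixes g :: "'a \<Rightarrow> ennreal"
  assumes "\<And>x. x \<in> X \<Longrightarrow> g x \<le> c"
  shows "esssup (count_space X) g \<le> c"
  by (rule esssup_I) (use assms in \<open>simp_all add: AE_count_space\<close>)

text \<open>For \<open>p = \<infinity>\<close> the factor \<open>b powr exponent_inverse p\<close> is \<open>1\<close>, so one formula covers all \<open>p\<close>.\<close>

lemma lp_norm_finite_support_le:
  assumes p: "1 \<le> p" and t: "t \<ge> 0" "\<And>x. x \<in> X \<Longrightarrow> g x \<le> ennreal t"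
    and Y: "finite {x \<in> X. g x \<noteq> 0}" "real (card {x \<in> X. g x \<noteq> 0}) \<le> b" and b: "b > 0"
  shows "lp_norm p (count_space X) g \<le> ennreal (b powr exponent_inverse p * t)"
  using p
proof (cases rule: exponent_cases)
  case 1
  then show ?thesis
    using esssup_count_space_le[of X g "ennreal t"] t b by (simp add: lp_norm_def)
next
  case (2 r)
  let ?Y = "{x \<in> X. g x \<noteq> 0}"
  have "(\<integral>\<^sup>+x. ennreal_powr (g x) r \<partial>count_space X) = (\<Sum>x\<in>?Y. ennreal_powr (g x) r)"
    by (rule nn_integral_count_space') (use Y in \<open>auto simp: ennreal_powr_def\<close>)
  also have "\<dots> \<le> (\<Sum>x\<in>?Y. ennreal (t powr r))"
  proof (rule sum_mono)
    fix x assume "x \<in> ?Y"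
    then show "ennreal_powr (g x) r \<le> ennreal (t powr r)"
      using ennreal_powr_mono[of "g x" "ennreal t" r] t 2(2) by (simp add: ennreal_powr_ennreal)
  qed
  also have "\<dots> = ennreal (real (card ?Y) * t powr r)"
    by (simp add: ennreal_mult ennreal_of_nat_eq_real_of_nat)
  also have "\<dots> \<le> ennreal (b * t powr r)"
    using Y(2) by (intro ennreal_leI mult_right_mono) auto
  finally have "ennreal_powr (\<integral>\<^sup>+x. ennreal_powr (g x) r \<partial>count_space X) (1 / r)
      \<le> ennreal_powr (ennreal (b * t powr r)) (1 / r)"
    using 2(2) by (intro ennreal_powr_mono) auto
  also have "\<dots> = ennreal (b powr (1 / r) * t)"
    using b t(1) 2(2) by (simp add: ennreal_powr_ennreal powr_mult powr_powr)
  finally show ?thesis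
    using 2 by (simp add: lp_norm_def)
qed

lemma nn_integral_geometric_count_space:
  assumes "finite B" "c \<ge> 0" "0 \<le> \<rho>" "\<rho> < 1"
  shows "(\<integral>\<^sup>+x. ennreal (c * \<rho> ^ (fst x - l)) \<partial>count_space ({l..} \<times> B)) = ennreal (real (card B) * (c / (1 - \<rho>)))"
proof -
  have bij: "bij_betw (\<lambda>(i, I). (i + l, I)) (UNIV \<times> B) ({l..} \<times> B)"
    by (rule bij_betw_byWitness[where f' = "\<lambda>(i, I). (i - l, I)"]) auto
  have "(\<integral>\<^sup>+x. ennreal (c * \<rho> ^ (fst x - l)) \<partial>count_space ({l..} \<times> B))
      = (\<integral>\<^sup>+x. ennreal (c * \<rho> ^ fst x) \<partial>count_space (UNIV \<times> B))"
    by (subst nn_integral_bij_count_space[OF bij, symmetric])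
       (simp add: case_prod_unfold)
  also have "\<dots> = (\<integral>\<^sup>+x. ennreal (c * \<rho> ^ fst x) * indicator B (snd x) \<partial>count_space UNIV)"
    by (subst nn_integral_count_space_indicator)
       (auto intro!: nn_integral_cong simp: indicator_def)
  also have "\<dots> = (\<integral>\<^sup>+i. \<integral>\<^sup>+I. ennreal (c * \<rho> ^ i) * indicator B I \<partial>count_space UNIV \<partial>count_space UNIV)"
    by (subst nn_integral_fst_count_space[symmetric]) simp
  also have "\<dots> = (\<integral>\<^sup>+i. ennreal (real (card B) * (c * \<rho> ^ i)) \<partial>count_space UNIV)"
  proof (intro nn_integral_cong)
    fix i
    have "(\<integral>\<^sup>+I. ennreal (c * \<rho> ^ i) * indicator B I \<partial>count_space UNIV) = ennreal (c * \<rho> ^ i) * of_nat (card B)"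
      using assms(1) by (subst nn_integral_cmult_indicator) simp_all
    also have "\<dots> = ennreal (real (card B) * (c * \<rho> ^ i))"
      using assms(2,3) by (simp add: ennreal_mult ennreal_of_nat_eq_real_of_nat mult.commute)
    finally show "(\<integral>\<^sup>+I. ennreal (c * \<rho> ^ i) * indicator B I \<partial>count_space UNIV)
        = ennreal (real (card B) * (c * \<rho> ^ i))" .
  qed
  also have "\<dots> = (\<Sum>i. ennreal (real (card B) * (c * \<rho> ^ i)))"
    by (rule nn_integral_count_space_nat)
  also have "\<dots> = ennreal (real (card B) * (c / (1 - \<rho>)))"
  proof (rule suminf_ennreal_eq)
    show "0 \<le> real (card B) * (c * \<rho> ^ i)" for i
      using assms by simp
    have "(\<lambda>i. real (card B) * (c * \<rho> ^ i)) sums (real (card B) * (c * (1 / (1 - \<rho>))))"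
      using assms(3,4) by (intro sums_mult geometric_sums) simp
    then show "(\<lambda>i. real (card B) * (c * \<rho> ^ i)) sums (real (card B) * (c / (1 - \<rho>)))"
      by simp
  qed
  finally show ?thesis .
qed

text \<open>The constant \<open>D\<close> does not depend on the first index \<open>l\<close>, which makes the bound uniform over all
  cubes.\<close>

lemma lp_norm_geometric_le:
  fixes B :: "'i set"
  assumes q: "1 \<le> q" and "finite B" and \<epsilon>: "\<epsilon> \<ge> 0" "q = \<infinity> \<or> \<epsilon> > 0"
  shows "\<exists>D\<ge>0. \<forall>l t g. t \<ge> 0 \<longrightarrow>
    (\<forall>j I. l \<le> j \<longrightarrow> I \<in> B \<longrightarrow> g (j, I) \<le> ennreal (t * 2 powr (- \<epsilon> * real (j - l)))) \<longrightarrow>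
    lp_norm q (count_space ({l..} \<times> B)) g \<le> ennreal (t * D)"
  using q
proof (cases rule: exponent_cases)
  case 1
  have "lp_norm q (count_space ({l..} \<times> B)) g \<le> ennreal (t * 1)"
    if "t \<ge> 0" and g: "\<forall>j I. l \<le> j \<longrightarrow> I \<in> B \<longrightarrow> g (j, I) \<le> ennreal (t * 2 powr (- \<epsilon> * real (j - l)))"
    for l :: nat and t g
  proof -
    have "g x \<le> ennreal (t * 1)" if "x \<in> {l..} \<times> B" for x
    proof -
      have "g x \<le> ennreal (t * 2 powr (- \<epsilon> * real (fst x - l)))"
        using g that by (cases x) auto
      also have "2 powr (- \<epsilon> * real (fst x - l)) \<le> 2 powr 0"
        using \<epsilon>(1) by (intro powr_mono) auto
      then have "ennreal (t * 2 powr (- \<epsilon> * real (fst x - l))) \<le> ennreal (t * 1)"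
        using \<open>t \<ge> 0\<close> by (intro ennreal_leI mult_left_mono) auto
      finally show ?thesis .
    qed
    then show ?thesis
      using esssup_count_space_le[of "{l..} \<times> B" g] 1 by (simp add: lp_norm_def)
  qed
  then show ?thesis
    by (intro exI[of _ 1]) auto
next
  case (2 r)
  then have "\<epsilon> > 0"
    using \<epsilon> by simp
  define \<rho> where "\<rho> = 2 powr (- \<epsilon> * r)"
  have "- \<epsilon> * r < 0"
    using \<open>\<epsilon> > 0\<close> 2(2) by (intro mult_neg_pos) auto
  then have \<rho>: "0 \<le> \<rho>" "\<rho> < 1"
    unfolding \<rho>_def using powr_less_mono[of "- \<epsilon> * r" 0 2] by auto
  define S where "S = real (card B) / (1 - \<rho>)"
  have S: "S \<ge> 0"
    using \<rho> by (simp add: S_def)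
  have "lp_norm q (count_space ({l..} \<times> B)) g \<le> ennreal (t * S powr (1 / r))"
    if t: "t \<ge> 0" and g: "\<forall>j I. l \<le> j \<longrightarrow> I \<in> B \<longrightarrow> g (j, I) \<le> ennreal (t * 2 powr (- \<epsilon> * real (j - l)))"
    for l :: nat and t g
  proof -
    have "(\<integral>\<^sup>+x. ennreal_powr (g x) r \<partial>count_space ({l..} \<times> B))
        \<le> (\<integral>\<^sup>+x. ennreal (t powr r * \<rho> ^ (fst x - l)) \<partial>count_space ({l..} \<times> B))"
    proof (rule nn_integral_mono)
      fix x assume "x \<in> space (count_space ({l..} \<times> B))"
      then have "g x \<le> ennreal (t * 2 powr (- \<epsilon> * real (fst x - l)))"
        using g by (cases x) auto
      then have "ennreal_powr (g x) r \<le> ennreal_powr (ennreal (t * 2 powr (- \<epsilon> * real (fst x - l)))) r"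
        using 2(2) by (intro ennreal_powr_mono) auto
      also have "\<dots> = ennreal ((t * 2 powr (- \<epsilon> * real (fst x - l))) powr r)"
        using t by (intro ennreal_powr_ennreal) simp
      also have "(t * 2 powr (- \<epsilon> * real (fst x - l))) powr r = t powr r * \<rho> ^ (fst x - l)"
        using t by (simp add: \<rho>_def powr_mult powr_powr powr_realpow[symmetric] mult_ac)
      finally show "ennreal_powr (g x) r \<le> ennreal (t powr r * \<rho> ^ (fst x - l))" .
    qed
    also have "\<dots> = ennreal (t powr r * S)"
      using nn_integral_geometric_count_space[OF \<open>finite B\<close> _ \<rho>, of "t powr r" l]
      by (simp add: S_def mult.commute)
    finally have "ennreal_powr (\<integral>\<^sup>+x. ennreal_powr (g x) r \<partial>count_space ({l..} \<times> B)) (1 / r)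
        \<le> ennreal_powr (ennreal (t powr r * S)) (1 / r)"
      using 2(2) by (intro ennreal_powr_mono) auto
    also have "\<dots> = ennreal (t * S powr (1 / r))"
      using t S 2(2) by (simp add: ennreal_powr_ennreal powr_mult powr_powr)
    finally show ?thesis
      using 2 by (simp add: lp_norm_def)
  qed
  then show ?thesis
    by (intro exI[of _ "S powr (1 / r)"]) auto
qed

text \<open>For cubes larger than the unit cube, where \<open>nat J = 0\<close>, only the lower bound \<open>1\<close> matters.\<close>

lemma measure_dyadic_cube_ge:
  fixes K :: "int ^ 'n"
  shows "measure lborel (dyadic_cube J K) \<ge> 2 powr (- real (nat J) * real CARD('n))"
proof -
  let ?a = "\<chi> a. 2 powi (- J) * real_of_int (K $ a)"
    and ?b = "\<chi> a. 2 powi (- J) * (real_of_int (K $ a) + 1)"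
  have mem: "?a \<in> cbox ?a ?b"
    by (auto simp: mem_box_cart)
  have "- J \<ge> - int (nat J)"
    by simp
  then have "2 powi (- J) \<ge> (2 powi (- int (nat J)) :: real)"
    by (intro power_int_increasing) auto
  also have "2 powi (- int (nat J)) = (2 powr (- real (nat J)) :: real)"
    by (simp add: powr_real_of_int'[symmetric])
  finally have edge: "2 powr (- real (nat J)) \<le> (2 powi (- J) :: real)" .
  have meas: "dyadic_cube J K \<in> sets borel"
  proof -
    have [measurable]: "(\<lambda>x :: real ^ 'n. x $ i) \<in> borel_measurable borel" for i
      by (intro borel_measurable_continuous_onI continuous_intros)
    have "Measurable.pred borel (\<lambda>x. \<forall>i. 2 powi (- J) * of_int (K $ i) \<le> x $ i \<and>
        x $ i < 2 powi (- J) * (real_of_int (K $ i) + 1))"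
      by measurable
    then show ?thesis
      unfolding dyadic_cube_def pred_def by simp
  qed
  have "dyadic_cube J K \<subseteq> cbox ?a ?b"
    by (auto simp: dyadic_cube_def mem_box_cart less_imp_le)
  then have "bounded (dyadic_cube J K)"
    using bounded_cbox bounded_subset by blast
  then have fm: "dyadic_cube J K \<in> fmeasurable lborel"
    using meas emeasure_bounded_finite by (intro fmeasurableI) auto
  have "2 powr (- real (nat J) * real CARD('n)) = (2 powr (- real (nat J))) ^ CARD('n)"
    by (simp add: powr_powr powr_realpow[symmetric])
  also have "\<dots> \<le> (2 powi (- J)) ^ CARD('n)"
    using edge by (intro power_mono) auto
  also have "\<dots> = (\<Prod>a\<in>UNIV. ?b $ a - ?a $ a)"
    by (simp add: algebra_simps)
  also have "\<dots> = measure lborel (cbox ?a ?b)"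
    using mem by (intro content_cbox_cart[symmetric]) auto
  also have "\<dots> = measure lborel (box ?a ?b)"
    by (simp add: measure_lborel_box_eq measure_lborel_cbox_eq)
  also have "\<dots> \<le> measure lborel (dyadic_cube J K)"
    using fm by (intro measure_mono_fmeasurable) (auto simp: dyadic_cube_def mem_box_cart less_imp_le)
  finally show ?thesis .
qed

lemma dyadic_cube_weight_le:
  fixes K :: "int ^ 'n"
  assumes "\<tau> \<ge> 0"
  shows "measure lborel (dyadic_cube J K) powr (- \<tau>) \<le> 2 powr (real (nat J) * real CARD('n) * \<tau>)"
proof -
  have "measure lborel (dyadic_cube J K) powr (- \<tau>) \<le> (2 powr (- real (nat J) * real CARD('n))) powr (- \<tau>)"
    using measure_dyadic_cube_ge[of J K] assms by (intro powr_mono2') auto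
  then show ?thesis
    by (simp add: powr_powr)
qed

text \<open>Let \<open>l\<close> be the generation of a cube, or \<open>0\<close> for a cube larger than the unit cube. The cube
  contributes, for each mother wavelet, at most \<open>N * 2 ^ ((j - l) * (n - 1))\<close> non-zero coefficients of
  generation \<open>j\<close>, each of size at most \<open>A * 2 powr (- j * n / 2)\<close>. The hypothesis on the exponents says that the resulting
  bound, together with the weights of the cube and of the generation, is of order
  \<open>2 powr (- \<epsilon> * (j - l))\<close>: a geometric series for \<open>\<epsilon> > 0\<close>, a bounded sequence for \<open>\<epsilon> = 0\<close>. The
  coefficients of the scaling functions are finitely many, and cubes of measure at least \<open>1\<close> have weight
  at most \<open>1\<close>.\<close>

lemma besov_type_seq_norm_finite:
  fixes E :: "(real ^ 'n) set"
  assumes p: "1 \<le> p" and q: "1 \<le> q" and \<tau>: "\<tau> > 0" and \<epsilon>: "\<epsilon> \<ge> 0" "q = \<infinity> \<or> \<epsilon> > 0"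
    and exponents: "\<And>l j :: nat. l \<le> j \<Longrightarrow>
      real l * real CARD('n) * \<tau> + real j * (s - real CARD('n) * exponent_inverse p)
        + real (j - l) * (real CARD('n) - 1) * exponent_inverse p \<le> - \<epsilon> * real (j - l)"
    and A: "A > 0" "\<And>I j k. \<bar>c I j k\<bar> \<le> A * 2 powr (- (real (j * CARD('n)) / 2))"
    and N: "N > 0"
    and count: "\<And>J (K :: int ^ 'n) j I. nat J \<le> j \<Longrightarrow> I \<noteq> {} \<Longrightarrow>
      finite {r. dyadic_cube (int j) r \<subseteq> dyadic_cube J K \<and> c I j r \<noteq> 0} \<and>
      real (card {r. dyadic_cube (int j) r \<subseteq> dyadic_cube J K \<and> c I j r \<noteq> 0})
        \<le> N * 2 ^ ((j - nat J) * (CARD('n) - 1))"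
    and low: "finite {r. c {} 0 r \<noteq> 0}" "real (card {r. c {} 0 r \<noteq> 0}) \<le> N"
  shows "besov_type_seq_norm s \<tau> p q (\<lambda>k. complex_of_real (c ({} :: 'n set) 0 k))
    (\<lambda>I j k. complex_of_real (c I j k)) < \<infinity>"
proof -
  let ?n = "real CARD('n)" and ?ip = "exponent_inverse p"
  let ?\<mu> = "\<lambda>J (K :: int ^ 'n). measure lborel (dyadic_cube J K) powr (- \<tau>)"
  have ip: "?ip \<ge> 0"
    by (simp add: exponent_inverse_def)
  have n: "real (CARD('n) - 1) = ?n - 1"
    by (simp add: of_nat_diff Suc_leI)
  have coarse: "ennreal (?\<mu> J K) * lp_norm p (count_space {m. dyadic_cube 0 m \<subseteq> dyadic_cube J K})
      (\<lambda>m. ennreal (norm (complex_of_real (c {} 0 m)))) \<le> ennreal (1 * (N powr ?ip * A))"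
    if "measure lborel (dyadic_cube J K) \<ge> 1" for J and K :: "int ^ 'n"
  proof -
    let ?X = "{m. dyadic_cube 0 m \<subseteq> dyadic_cube J K}"
    have sub: "{m \<in> ?X. ennreal (norm (complex_of_real (c {} 0 m))) \<noteq> 0} \<subseteq> {r. c {} 0 r \<noteq> 0}"
      by auto
    have "lp_norm p (count_space ?X) (\<lambda>m. ennreal (norm (complex_of_real (c {} 0 m)))) \<le> ennreal (N powr ?ip * A)"
    proof (rule lp_norm_finite_support_le[OF p])
      show "A \<ge> 0" "N > 0" using A N by simp_all
      show "ennreal (norm (complex_of_real (c {} 0 m))) \<le> ennreal A" for m
        using A(2)[of "{}" 0 m] by (intro ennreal_leI) simp
      show "finite {m \<in> ?X. ennreal (norm (complex_of_real (c {} 0 m))) \<noteq> 0}"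
        using sub low(1) by (rule finite_subset)
      have "card {m \<in> ?X. ennreal (norm (complex_of_real (c {} 0 m))) \<noteq> 0} \<le> card {r. c {} 0 r \<noteq> 0}"
        using low(1) sub by (rule card_mono)
      then show "real (card {m \<in> ?X. ennreal (norm (complex_of_real (c {} 0 m))) \<noteq> 0}) \<le> N"
        using low(2) by linarith
    qed
    moreover have "?\<mu> J K \<le> 1 powr (- \<tau>)"
      using that \<tau> by (intro powr_mono2') auto
    ultimately have "ennreal (?\<mu> J K) * lp_norm p (count_space ?X) (\<lambda>m. ennreal (norm (complex_of_real (c {} 0 m))))
        \<le> ennreal 1 * ennreal (N powr ?ip * A)"
      by (intro mult_mono ennreal_leI) auto
    then show ?thesis
      by simp
  qed
  obtain D where D: "D \<ge> 0" "\<And>l t g. t \<ge> 0 \<Longrightarrow>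
      (\<forall>j I. l \<le> j \<longrightarrow> I \<in> {I :: 'n set. I \<noteq> {}} \<longrightarrow> g (j, I) \<le> ennreal (t * 2 powr (- \<epsilon> * real (j - l)))) \<Longrightarrow>
      lp_norm q (count_space ({l..} \<times> {I :: 'n set. I \<noteq> {}})) g \<le> ennreal (t * D)"
    using lp_norm_geometric_le[OF q _ \<epsilon>, of "{I :: 'n set. I \<noteq> {}}"] by auto
  have fine: "ennreal (?\<mu> J K) *
        lp_norm q (count_space ({nat J..} \<times> {I. I \<noteq> {}}))
          (\<lambda>(j, I).
             ennreal (2 powr (real j * (s + ?n / 2 - ?n * ?ip))) *
             lp_norm p (count_space {m. dyadic_cube (int j) m \<subseteq> dyadic_cube J K})
               (\<lambda>m. ennreal (norm (complex_of_real (c I j m))))) \<le> ennreal (N powr ?ip * A * D)"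
    (is "_ * lp_norm q _ ?g \<le> _")
    for J and K :: "int ^ 'n"
  proof -
    define l where "l = nat J"
    define t where "t = N powr ?ip * A * 2 powr (- (real l * ?n * \<tau>))"
    have "t \<ge> 0"
      using A(1) by (simp add: t_def)
    have g: "?g (j, I) \<le> ennreal (t * 2 powr (- \<epsilon> * real (j - l)))" if "l \<le> j" "I \<noteq> {}" for j I
    proof -
      let ?X = "{m. dyadic_cube (int j) m \<subseteq> dyadic_cube J K}"
      let ?b = "N * 2 ^ ((j - l) * (CARD('n) - 1))" and ?t = "A * 2 powr (- (real (j * CARD('n)) / 2))"
      have eq: "{m \<in> ?X. ennreal (norm (complex_of_real (c I j m))) \<noteq> 0}
          = {r. dyadic_cube (int j) r \<subseteq> dyadic_cube J K \<and> c I j r \<noteq> 0}"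
        by auto
      have "lp_norm p (count_space ?X) (\<lambda>m. ennreal (norm (complex_of_real (c I j m))))
          \<le> ennreal (?b powr ?ip * ?t)"
      proof (rule lp_norm_finite_support_le[OF p])
        show "?t \<ge> 0" "?b > 0" using A(1) N by simp_all
        show "ennreal (norm (complex_of_real (c I j m))) \<le> ennreal ?t" for m
          using A(2)[of I j m] by (intro ennreal_leI) simp
      qed (use count[of J j I K] that in \<open>simp_all add: eq l_def\<close>)
      then have "?g (j, I) \<le> ennreal (2 powr (real j * (s + ?n / 2 - ?n * ?ip))) * ennreal (?b powr ?ip * ?t)"
        by (simp add: mult_left_mono)
      also have "\<dots> = ennreal (2 powr (real j * (s + ?n / 2 - ?n * ?ip)) * (?b powr ?ip * ?t))"
        by (intro ennreal_mult[symmetric]) (use A(1) in auto)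
      also have "?b powr ?ip = N powr ?ip * 2 powr (real (j - l) * (?n - 1) * ?ip)"
        using N by (simp add: powr_mult powr_powr powr_realpow[symmetric] n)
      also have "2 powr (real j * (s + ?n / 2 - ?n * ?ip)) * (N powr ?ip * 2 powr (real (j - l) * (?n - 1) * ?ip) * ?t)
          = N powr ?ip * A * 2 powr (real j * (s - ?n * ?ip) + real (j - l) * (?n - 1) * ?ip)"
        by (simp add: powr_add[symmetric] algebra_simps flip: powr_add)
      also have "\<dots> \<le> N powr ?ip * A * 2 powr (- (real l * ?n * \<tau>) - \<epsilon> * real (j - l))"
        using A(1) exponents[OF \<open>l \<le> j\<close>] by (intro mult_left_mono powr_mono) auto
      also have "\<dots> = t * 2 powr (- \<epsilon> * real (j - l))"
        by (simp add: t_def powr_add[symmetric])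
      finally show ?thesis
        by (simp add: ennreal_leI)
    qed
    have "ennreal (?\<mu> J K) * lp_norm q (count_space ({l..} \<times> {I. I \<noteq> {}})) ?g
        \<le> ennreal (2 powr (real l * ?n * \<tau>)) * ennreal (t * D)"
      using dyadic_cube_weight_le[of \<tau> J K] \<tau> g \<open>t \<ge> 0\<close> unfolding l_def[symmetric]
      by (intro mult_mono ennreal_leI D(2)) auto
    also have "\<dots> = ennreal (2 powr (real l * ?n * \<tau>) * (t * D))"
      using \<open>t \<ge> 0\<close> D(1) by (intro ennreal_mult[symmetric]) auto
    also have "2 powr (real l * ?n * \<tau>) * (t * D) = N powr ?ip * A * D"
      by (simp add: t_def powr_minus)
    finally show ?thesis
      unfolding l_def .
  qed
  have "besov_type_seq_norm s \<tau> p q (\<lambda>k. complex_of_real (c ({} :: 'n set) 0 k))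
    (\<lambda>I j k. complex_of_real (c I j k)) \<le> ennreal (1 * (N powr ?ip * A)) + ennreal (N powr ?ip * A * D)"
    unfolding besov_type_seq_norm_def
    by (intro add_mono SUP_least) (use coarse fine in \<open>auto simp del: mult_1_left\<close>)
  also have "\<dots> < \<infinity>"
    by simp
  finally show ?thesis .
qed


section \<open>Maximal regularity\<close>

text \<open>In the first family \<open>\<tau> * n \<le> (n - 1) / p\<close>, so the weight of a cube of generation \<open>l\<close> is absorbed by
  the factor \<open>2 powr (- l * (n - 1) / p)\<close> of the counting bound; no decay in \<open>j - l\<close> is left, which
  \<open>q = \<infinity>\<close> tolerates. In the second family the smoothness \<open>s\<close> is chosen such that the exponent depends on
  \<open>j - l\<close> only, and \<open>\<epsilon> = n * \<tau> - (n - 1) / p\<close> is positive.\<close>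

lemma max_regularity_params_decay:
  assumes "(s, \<tau>, p, q) \<in> max_regularity_params n" "n \<ge> 1"
  shows "1 \<le> p" "1 \<le> q" "\<tau> > 0"
    "\<exists>\<epsilon>\<ge>0. (q = \<infinity> \<or> \<epsilon> > 0) \<and> (\<forall>l j :: nat. l \<le> j \<longrightarrow>
      real l * real n * \<tau> + real j * (s - real n * exponent_inverse p)
        + real (j - l) * (real n - 1) * exponent_inverse p \<le> - \<epsilon> * real (j - l))"
proof -
  let ?ip = "exponent_inverse p"
  have ip: "?ip \<ge> 0"
    by (simp add: exponent_inverse_def)
  have n: "real n \<ge> 1"
    using assms(2) by simp
  consider (slow) "s = ?ip" "q = \<infinity>" "1 \<le> p" "0 < \<tau>" "\<tau> \<le> (real n - 1) / real n * ?ip"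
    | (fast) "s = real n * (?ip - \<tau>)" "1 \<le> p" "1 \<le> q" "(real n - 1) / real n * ?ip < \<tau>"
    using assms(1) unfolding max_regularity_params_def by auto
  then have "1 \<le> p \<and> 1 \<le> q \<and> \<tau> > 0 \<and> (\<exists>\<epsilon>\<ge>0. (q = \<infinity> \<or> \<epsilon> > 0) \<and> (\<forall>l j :: nat. l \<le> j \<longrightarrow>
      real l * real n * \<tau> + real j * (s - real n * ?ip)
        + real (j - l) * (real n - 1) * ?ip \<le> - \<epsilon> * real (j - l)))"
  proof cases
    case slow
    have le: "real n * \<tau> \<le> (real n - 1) * ?ip"
      using slow(5) n by (simp add: field_simps)
    have "real l * real n * \<tau> + real j * (s - real n * ?ip) + real (j - l) * (real n - 1) * ?ip \<le> - 0 * real (j - l)"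
      if "l \<le> j" for l j :: nat
    proof -
      have "real l * real n * \<tau> + real j * (s - real n * ?ip) + real (j - l) * (real n - 1) * ?ip
          = real l * (real n * \<tau> - (real n - 1) * ?ip)"
        using that slow(1) by (simp add: of_nat_diff algebra_simps)
      also have "\<dots> \<le> 0"
        using le by (intro mult_nonneg_nonpos) auto
      finally show ?thesis by simp
    qed
    then show ?thesis
      using slow by (intro conjI exI[of _ 0]) auto
  next
    case fast
    let ?\<epsilon> = "real n * \<tau> - (real n - 1) * ?ip"
    have "(real n - 1) / real n * ?ip \<ge> 0"
      using n ip by simp
    then have "\<tau> > 0"
      using fast(4) by linarith
    have "?\<epsilon> > 0"
      using fast(4) n by (simp add: field_simps)
    have "real l * real n * \<tau> + real j * (s - real n * ?ip) + real (j - l) * (real n - 1) * ?ip \<le> - ?\<epsilon> * real (j - l)"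
      if "l \<le> j" for l j :: nat
    proof -
      have s: "s - real n * ?ip = - (real n * \<tau>)"
        using fast(1) by (simp add: algebra_simps)
      show ?thesis
        unfolding s using that by (simp add: of_nat_diff algebra_simps)
    qed
    then show ?thesis
      using fast \<open>\<tau> > 0\<close> \<open>?\<epsilon> > 0\<close> by (intro conjI exI[of _ ?\<epsilon>]) auto
  qed
  then show "1 \<le> p" "1 \<le> q" "\<tau> > 0" "\<exists>\<epsilon>\<ge>0. (q = \<infinity> \<or> \<epsilon> > 0) \<and> (\<forall>l j :: nat. l \<le> j \<longrightarrow>
      real l * real n * \<tau> + real j * (s - real n * ?ip)
        + real (j - l) * (real n - 1) * ?ip \<le> - \<epsilon> * real (j - l))"
    by blast+
qed

theorem corollary4p18:
  fixes E :: "(real ^ 'n) set" and \<phi>0 \<phi> :: "real ^ 'n \<Rightarrow> complex"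
  assumes "littlewood_paley_pair \<phi>0 \<phi>"
    and "open E" "bounded E" "E \<noteq> {}"
    and "\<forall>(s, \<tau>, p, q) \<in> max_regularity_params CARD('n).
           \<exists>N1 \<phi>w \<psi>w. admissible_wavelet_system \<phi>0 \<phi> s \<tau> p q N1 \<phi>w \<psi>w \<and>
             (\<exists>C::real. \<forall>(l::nat) (m :: int ^ 'n) (j::nat). l \<le> j \<longrightarrow>
                real (card (boundary_indices \<phi>w \<psi>w E j \<inter>
                            {r. dyadic_cube (int j) r \<subseteq> dyadic_cube (int l) m}))
                  \<le> C * 2 ^ ((j - l) * (CARD('n) - 1)))"
  shows "max_regularity \<phi>0 \<phi> E"
  unfolding max_regularity_def
proof (intro ballI, clarify)
  fix s \<tau> :: real and p q :: ennreal
  assume params: "(s, \<tau>, p, q) \<in> max_regularity_params CARD('n)"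
  obtain N1 \<phi>w \<psi>w C where adm: "admissible_wavelet_system \<phi>0 \<phi> s \<tau> p q N1 \<phi>w \<psi>w"
    and C: "\<And>(l::nat) (m :: int ^ 'n) (j::nat). l \<le> j \<Longrightarrow>
      real (card (boundary_indices \<phi>w \<psi>w E j \<inter> {r. dyadic_cube (int j) r \<subseteq> dyadic_cube (int l) m}))
        \<le> C * 2 ^ ((j - l) * (CARD('n) - 1))"
    using bspec[OF assms(5) params] by auto
  have sys: "wavelet_system TYPE('n) N1 \<phi>w \<psi>w"
    and char: "wavelet_characterization \<phi>0 \<phi> s \<tau> p q N1 \<phi>w \<psi>w"
    using adm unfolding admissible_wavelet_system_def by auto
  let ?c = "indicator_coefficient \<phi>w \<psi>w E"
  let ?f = "indicator_distribution E"
  have "wavelet_coefficients N1 \<phi>w \<psi>w ?f (\<lambda>k. complex_of_real (?c {} 0 k)) (\<lambda>I j k. complex_of_real (?c I j k))"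
    unfolding wavelet_coefficients_def indicator_coefficient_def
    using has_bracket_indicator_distribution[OF assms(2,3) continuous_on_wavelet[OF sys]] by blast
  moreover have temp: "tempered_distribution ?f"
    by (rule tempered_indicator_distribution[OF assms(2,3)])
  ultimately obtain c2 where "besov_type_norm \<phi>0 \<phi> s \<tau> p q ?f \<le> ennreal c2 *
      besov_type_seq_norm s \<tau> p q (\<lambda>k. complex_of_real (?c {} 0 k)) (\<lambda>I j k. complex_of_real (?c I j k))"
    using char unfolding wavelet_characterization_def by blast
  also have "\<dots> < \<infinity>"
  proof -
    have n: "1 \<le> CARD('n)"
      by (simp add: Suc_leI)
    note pars = max_regularity_params_decay[OF params n]
    obtain \<epsilon> where \<epsilon>: "\<epsilon> \<ge> 0" "q = \<infinity> \<or> \<epsilon> > 0" and decay: "\<And>l j :: nat. l \<le> j \<Longrightarrow>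
      real l * real CARD('n) * \<tau> + real j * (s - real CARD('n) * exponent_inverse p)
        + real (j - l) * (real CARD('n) - 1) * exponent_inverse p \<le> - \<epsilon> * real (j - l)"
      using pars(4) by auto
    obtain A where A: "A > 0" "\<And>I j k. \<bar>?c I j k\<bar> \<le> A * 2 powr (- (real (j * CARD('n)) / 2))"
      using indicator_coefficient_bound[OF sys assms(2,3)] by auto
    obtain N where N: "N > 0"
      and count: "\<And>J (K :: int ^ 'n) j I. nat J \<le> j \<Longrightarrow> I \<noteq> {} \<Longrightarrow>
        finite {r. dyadic_cube (int j) r \<subseteq> dyadic_cube J K \<and> ?c I j r \<noteq> 0} \<and>
        real (card {r. dyadic_cube (int j) r \<subseteq> dyadic_cube J K \<and> ?c I j r \<noteq> 0})
          \<le> N * 2 ^ ((j - nat J) * (CARD('n) - 1))"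
      and low: "finite {r. ?c {} 0 r \<noteq> 0}" "real (card {r. ?c {} 0 r \<noteq> 0}) \<le> N"
      using coefficient_count[OF sys assms(2,3) C] unfolding Let_def by auto
    have "besov_type_seq_norm s \<tau> p q (\<lambda>k. complex_of_real (?c {} 0 k)) (\<lambda>I j k. complex_of_real (?c I j k)) < \<infinity>"
      by (rule besov_type_seq_norm_finite[where c = ?c, OF pars(1-3) \<epsilon> decay A N count low])
    then show ?thesis
      by (simp add: ennreal_mult_less_top)
  qed
  finally show "?f \<in> besov_type_space \<phi>0 \<phi> s \<tau> p q"
    using temp unfolding besov_type_space_def by simp
qed

end
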